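(* Let $g,k\ge1$, and let $G$ be an Abelian group. (i) Let $n\ge1$, and let $P_G:B_{k,n}(\widehat\Sigma_g)\to G$ and $\overline{P_G}:B_{k,n}/\Gamma_2(B_{k,n})\to G$ be homomorphisms for which $P_G\circ\iota_{k,n}=\overline{P_G}\circ r_{k,n}$. Then $\overline{P_G}$ is not injective. In particular, the homomorphism $\bar\iota_{k,n}:B_{k,n}/\Gamma_2(B_{k,n})\to B_{k,n}(\widehat\Sigma_g)/\Gamma_2(B_{k,n}(\widehat\Sigma_g))$ induced by $\iota_{k,n}$ is not injective. (ii) Let $n\ge0$, and let $\bar\iota_k:B_k(\mathbb D_n)/\Gamma_2(B_k(\mathbb D_n))\to B_k(\widehat\Sigma_{g,n})/\Gamma_2(B_k(\widehat\Sigma_{g,n}))$ be the homomorphism induced by $\iota_k$. (a) If $k=1$ then $\bar\iota_k$ is injective. (b) Suppose that $k\ge2$. Let $P_G:B_k(\widehat\Sigma_{g,n})\to G$ and $\overline{P_G}:B_k(\mathbb D_n)/\Gamma_2(B_k(\mathbb D_n))\to G$ be homomorphisms for which $P_G\circ\iota_k=\overline{P_G}\circ r_k$. Then $\overline{P_G}$ is not injective. In particular, $\bar\iota_k$ is not injective.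
   Context: For a connected surface $\Sigma$, $\mathbb F_m(\Sigma)=\{(x_1,\dots,x_m)\in\Sigma^m: x_i\neq x_j\ (i\ne j)\}$, $B_n(\Sigma)=\pi_1(\mathbb F_n(\Sigma)/S_n)$, $B_{k,n}(\Sigma)=\pi_1(\mathbb F_{k+n}(\Sigma)/(S_k\times S_n))$; $B_{k,n}=B_{k,n}(\mathbb D^2)$; $\mathbb D_n$ is the disc minus $n$ interior points ($\mathbb D_0=\mathbb D^2$). $\widehat\Sigma_g$ is a compact connected orientable surface of genus $g$ with one boundary component, $\widehat\Sigma_{g,n}$ is $\widehat\Sigma_g$ minus $n$ interior points. $\Gamma_2(G)=[G,G]$, $[x,y]=xyx^{-1}y^{-1}$, $x^y=y^{-1}xy$. $r_{k,n}:B_{k,n}\to B_{k,n}/\Gamma_2(B_{k,n})$ and $r_k:B_k(\mathbb D_n)\to B_k(\mathbb D_n)/\Gamma_2(B_k(\mathbb D_n))$ are the canonical projections. $\iota_{k,n}:B_{k,n}\to B_{k,n}(\widehat\Sigma_g)$ and $\iota_k:B_k(\mathbb D_n)\to B_k(\widehat\Sigma_{g,n})$ are the natural inclusions induced by embedding a disc in $\widehat\Sigma_g$ (containing the $n$ punctures for $\iota_k$). Presentation of $B_{k,n}(\widehat\Sigma_g)$. Generators: $S=\{\sigma_1,\dots,\sigma_{k-1}\}$, $\widetilde S=\{\tilde\sigma_1,\dots,\tilde\sigma_{n-1}\}$, $AB=\{a_1,b_1,\dots,a_g,b_g\}$, $\widetilde{AB}=\{\tilde a_1,\tilde b_1,\dots,\tilde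 a_g,\tilde b_g\}$, $Z=\{\zeta_1,\dots,\zeta_n\}$. Write $c<d$ for $c\in\{a_i,b_i\}$, $d\in\{a_j,b_j\}$, $i<j$. Relations (for all indices for which they make sense): (a) $\sigma_i\sigma_j=\sigma_j\sigma_i$ for $|i-j|\ge2$; $\sigma_i\sigma_{i+1}\sigma_i=\sigma_{i+1}\sigma_i\sigma_{i+1}$; $c\sigma_i=\sigma_ic$ for $i\neq1$, $c\in AB\cup Z$; $c\sigma_1c\sigma_1=\sigma_1c\sigma_1c$ for $c\in AB\cup Z$; $a_i\sigma_1b_i=\sigma_1b_i\sigma_1a_i\sigma_1$; $\sigma_1^{-1}c\sigma_1$ commutes with $d$ for $c,d\in AB$, $c<d$; $\sigma_1^{-1}\zeta_i\sigma_1$ commutes with every $c\in AB$, and with $\zeta_j$ for $i<j$. (b) The relations of (a) among $S\cup AB$ only, with $k$ replaced by $n$ and $\sigma_i,a_i,b_i$ by $\tilde\sigma_i,\tilde a_i,\tilde b_i$. (c) $\tilde\sigma_i,\tilde a_i,\tilde b_i$ commute with every $\sigma_j$; $\tilde\sigma_i$ commutes with $a_j,b_j$; $\tilde\sigma_i\zeta_{i+1}\tilde\sigma_i^{-1}=\zeta_i$; $\tilde\sigma_i\zeta_i\tilde\sigma_i^{-1}=\zeta_i^{-1}\zeta_{i+1}\zeta_i$; $\tilde\sigma_i\zeta_j\tilde\sigma_i^{-1}=\zeta_j$ for $j\ne i,i+1$; for $(\tilde x,x)=(\tilde a_i,a_i)$ or $(\tilde b_i,b_i)$: $\tilde x\zeta_1\tilde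 x^{-1}=\zeta_1^{x\zeta_1}$, $\tilde x\zeta_j\tilde x^{-1}=\zeta_j^{[x^{-1},\zeta_1^{-1}]}$ for $j\ne1$, $\tilde xx\tilde x^{-1}=\zeta_1^{-1}x\zeta_1$, and for $d\in\{a_j,b_j\}$, $\tilde xd\tilde x^{-1}=d^{[x^{-1},\zeta_1^{-1}]}$ if $i>j$, $\tilde xd\tilde x^{-1}=d$ if $j>i$; $\tilde a_ib_i\tilde a_i^{-1}=b_i\zeta_1$; $\tilde b_ia_i\tilde b_i^{-1}=\zeta_1^{-1}a_i[b_i^{-1},\zeta_1^{-1}]$. $B_k(\widehat\Sigma_{g,n})$ has generators $S\cup AB\cup Z$ and relations (a) (with $Z=\varnothing$ if $n=0$). For $g=0$ (no $AB$, $\widetilde{AB}$) one gets presentations of $B_{k,n}$ and $B_k(\mathbb D_n)$; $\iota_{k,n}$ and $\iota_k$ send each generator to the generator of the same name. *)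

theory Defs
  imports "HOL-Analysis.Analysis" "HOL-Algebra.Generated_Groups"
begin

section \<open>Quotient topologies\<close>

definition quotient_topology :: "'a topology \<Rightarrow> ('a \<Rightarrow> 'b) \<Rightarrow> 'b topology" where
  "quotient_topology X q =
     topology (\<lambda>U. U \<subseteq> q ` topspace X \<and> openin X {x \<in> topspace X. q x \<in> U})"

lemma openin_quotient_topology:
  "openin (quotient_topology X q) U \<longleftrightarrow>
     U \<subseteq> q ` topspace X \<and> openin X {x \<in> topspace X. q x \<in> U}"
proof -
  have "istopology (\<lambda>U. U \<subseteq> q ` topspace X \<and> openin X {x \<in> topspace X. q x \<in> U})"
  proof (unfold istopology_def, intro conjI allI impI)
    fix S T
    assume "S \<subseteq> q ` topspace X \<and> openin X {x \<in> topspace X. q x \<in> S}"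
      and "T \<subseteq> q ` topspace X \<and> openin X {x \<in> topspace X. q x \<in> T}"
    moreover have "{x \<in> topspace X. q x \<in> S \<inter> T}
        = {x \<in> topspace X. q x \<in> S} \<inter> {x \<in> topspace X. q x \<in> T}" by auto
    ultimately show "S \<inter> T \<subseteq> q ` topspace X" "openin X {x \<in> topspace X. q x \<in> S \<inter> T}"
      by auto
  next
    fix K
    assume *: "\<forall>S\<in>K. S \<subseteq> q ` topspace X \<and> openin X {x \<in> topspace X. q x \<in> S}"
    have "{x \<in> topspace X. q x \<in> \<Union> K} = (\<Union>S\<in>K. {x \<in> topspace X. q x \<in> S})" by auto
    with * show "\<Union> K \<subseteq> q ` topspace X" "openin X {x \<in> topspace X. q x \<in> \<Union> K}"
      by auto
  qed
  then show ?thesis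
    by (simp add: quotient_topology_def)
qed

lemma topspace_quotient_topology: "topspace (quotient_topology X q) = q ` topspace X"
proof
  show "topspace (quotient_topology X q) \<subseteq> q ` topspace X"
    using openin_topspace[of "quotient_topology X q"]
    unfolding openin_quotient_topology by blast
  have "{x \<in> topspace X. q x \<in> q ` topspace X} = topspace X" by auto
  then show "q ` topspace X \<subseteq> topspace (quotient_topology X q)"
    by (intro openin_subset) (simp add: openin_quotient_topology)
qed

lemma quotient_map_quotient_topology: "quotient_map X (quotient_topology X q) q"
  unfolding quotient_map_def topspace_quotient_topology openin_quotient_topology by auto


section \<open>Fundamental groups\<close>

definition loops :: "'a topology \<Rightarrow> 'a \<Rightarrow> (real \<Rightarrow> 'a) set" where
  "loops X x = {\<gamma>. pathin X \<gamma> \<and> \<gamma> 0 = x \<and> \<gamma> 1 = x}"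

definition loop_class :: "'a topology \<Rightarrow> 'a \<Rightarrow> (real \<Rightarrow> 'a) \<Rightarrow> (real \<Rightarrow> 'a) set" where
  "loop_class X x \<gamma> =
     {\<delta>. homotopic_with (\<lambda>h. h 0 = x \<and> h 1 = x) (top_of_set {0..1}) X \<gamma> \<delta>}"

text \<open>The library's \<open>joinpaths\<close> is restricted to codomains in class \<open>topological_space\<close>,
  whereas the spaces below are values of type \<open>topology\<close>.\<close>

definition join :: "(real \<Rightarrow> 'a) \<Rightarrow> (real \<Rightarrow> 'a) \<Rightarrow> real \<Rightarrow> 'a" where
  "join \<gamma> \<delta> = (\<lambda>t. if t \<le> 1/2 then \<gamma> (2 * t) else \<delta> (2 * t - 1))"

text \<open>Functions on equivalence classes are lifted by the union over representatives, as in
  theory \<open>HOL.Equiv_Relations\<close>; all the sets in such a union coincide.\<close>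

definition pi1 :: "'a topology \<Rightarrow> 'a \<Rightarrow> (real \<Rightarrow> 'a) set monoid" where
  "pi1 X x = \<lparr>carrier = loop_class X x ` loops X x,
              mult = (\<lambda>K L. \<Union>\<gamma>\<in>K. \<Union>\<delta>\<in>L. loop_class X x (join \<gamma> \<delta>)),
              one = loop_class X x (\<lambda>_. x)\<rparr>"

text \<open>The homomorphism \<open>\<pi>\<^sub>1(X, x) \<rightarrow> \<pi>\<^sub>1(Y, y)\<close> induced by a continuous map \<open>f\<close> from \<open>X\<close>
  to \<open>Y\<close> with \<open>f x = y\<close>.\<close>

definition pi1_map :: "'b topology \<Rightarrow> 'b \<Rightarrow> ('a \<Rightarrow> 'b) \<Rightarrow> (real \<Rightarrow> 'a) set \<Rightarrow> (real \<Rightarrow> 'b) set" where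
  "pi1_map Y y f K = (\<Union>\<gamma>\<in>K. loop_class Y y (f \<circ> \<gamma>))"


section \<open>Abelianization\<close>

abbreviation Gamma2 :: "('a, 'b) monoid_scheme \<Rightarrow> 'a set" where
  "Gamma2 G \<equiv> derived G (carrier G)"

abbreviation abelianization :: "('a, 'b) monoid_scheme \<Rightarrow> 'a set monoid" where
  "abelianization G \<equiv> G Mod Gamma2 G"

definition ab_proj :: "('a, 'b) monoid_scheme \<Rightarrow> 'a \<Rightarrow> 'a set" where
  "ab_proj G x = Gamma2 G #>\<^bsub>G\<^esub> x"

text \<open>The map from the abelianization of the domain of \<open>f\<close> to that of the group \<open>H\<close>.\<close>

definition ab_map :: "('b, 'c) monoid_scheme \<Rightarrow> ('a \<Rightarrow> 'b) \<Rightarrow> 'a set \<Rightarrow> 'b set" where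
  "ab_map H f C = (\<Union>x\<in>C. ab_proj H (f x))"


section \<open>Configuration spaces and braid groups\<close>

definition config :: "'a topology \<Rightarrow> nat \<Rightarrow> (nat \<Rightarrow> 'a) topology" where
  "config X m = subtopology (product_topology (\<lambda>_. X) {..<m}) {c. inj_on c {..<m}}"

definition orbit :: "(nat \<Rightarrow> nat) set \<Rightarrow> (nat \<Rightarrow> 'a) \<Rightarrow> (nat \<Rightarrow> 'a) set" where
  "orbit H c = (\<lambda>\<pi>. c \<circ> \<pi>) ` H"

definition config_quotient ::
    "'a topology \<Rightarrow> nat \<Rightarrow> (nat \<Rightarrow> nat) set \<Rightarrow> (nat \<Rightarrow> 'a) set topology" where
  "config_quotient X m H = quotient_topology (config X m) (orbit H)"

definition perms :: "nat \<Rightarrow> (nat \<Rightarrow> nat) set" where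
  "perms k = {\<pi>. \<pi> permutes {..<k}}"

text \<open>\<open>S\<^sub>k \<times> S\<^sub>n\<close> as a subgroup of \<open>S\<^sub>k\<^sub>+\<^sub>n\<close>.\<close>

definition mixed_perms :: "nat \<Rightarrow> nat \<Rightarrow> (nat \<Rightarrow> nat) set" where
  "mixed_perms k n = {\<pi>. \<pi> permutes {..<k + n} \<and> \<pi> ` {..<k} = {..<k}}"

text \<open>The ordered configuration \<open>c\<close> represents the base point.\<close>

definition braid_group :: "'a topology \<Rightarrow> nat \<Rightarrow> (nat \<Rightarrow> 'a) \<Rightarrow> (real \<Rightarrow> (nat \<Rightarrow> 'a) set) set monoid" where
  "braid_group X k c = pi1 (config_quotient X k (perms k)) (orbit (perms k) c)"

definition mixed_braid_group ::
    "'a topology \<Rightarrow> nat \<Rightarrow> nat \<Rightarrow> (nat \<Rightarrow> 'a) \<Rightarrow> (real \<Rightarrow> (nat \<Rightarrow> 'a) set) set monoid" where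
  "mixed_braid_group X k n c =
     pi1 (config_quotient X (k + n) (mixed_perms k n)) (orbit (mixed_perms k n) c)"

definition config_map :: "('a \<Rightarrow> 'b) \<Rightarrow> nat \<Rightarrow> (nat \<Rightarrow> 'a) \<Rightarrow> nat \<Rightarrow> 'b" where
  "config_map f m c = (\<lambda>i\<in>{..<m}. f (c i))"

text \<open>The homomorphisms induced by an injective continuous map \<open>f\<close> into \<open>Y\<close>; they start at the
  braid group with base point \<open>c\<close> and end at the one with base point \<open>config_map f m c\<close>.\<close>

definition braid_map ::
    "'b topology \<Rightarrow> nat \<Rightarrow> (nat \<Rightarrow> 'a) \<Rightarrow> ('a \<Rightarrow> 'b)
     \<Rightarrow> (real \<Rightarrow> (nat \<Rightarrow> 'a) set) set \<Rightarrow> (real \<Rightarrow> (nat \<Rightarrow> 'b) set) set" where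
  "braid_map Y k c f =
     pi1_map (config_quotient Y k (perms k)) (orbit (perms k) (config_map f k c))
             ((`) (config_map f k))"

definition mixed_braid_map ::
    "'b topology \<Rightarrow> nat \<Rightarrow> nat \<Rightarrow> (nat \<Rightarrow> 'a) \<Rightarrow> ('a \<Rightarrow> 'b)
     \<Rightarrow> (real \<Rightarrow> (nat \<Rightarrow> 'a) set) set \<Rightarrow> (real \<Rightarrow> (nat \<Rightarrow> 'b) set) set" where
  "mixed_braid_map Y k n c f =
     pi1_map (config_quotient Y (k + n) (mixed_perms k n))
             (orbit (mixed_perms k n) (config_map f (k + n) c))
             ((`) (config_map f (k + n)))"


section \<open>The surfaces\<close>

definition disc :: "complex topology" where
  "disc = top_of_set (cball 0 1)"

text \<open>The genus \<open>g\<close> surface with one boundary component is obtained from the closed unit disc by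
  gluing \<open>4 * g\<close> disjoint closed arcs of its boundary circle. The arcs are numbered
  anticlockwise, and \<open>arc_point g m\<close> parametrizes the one with number \<open>m\<close> anticlockwise over
  \<open>[0, 1]\<close>. For each \<open>i < g\<close>, arc \<open>4 * i\<close> is glued to arc \<open>4 * i + 2\<close> and arc \<open>4 * i + 1\<close>
  to arc \<open>4 * i + 3\<close>, each time reversing the direction. So the boundary word, with gaps between
  the letters, is a product of commutators; this is the \<open>4 * g\<close>-gon model of the closed surface
  with a neighbourhood of its single vertex removed. The gaps form the single boundary circle.\<close>

definition arc_point :: "nat \<Rightarrow> nat \<Rightarrow> real \<Rightarrow> complex" where
  "arc_point g m s = cis (pi * (2 * real m + s) / (8 * real g))"

definition arc_pairs :: "nat \<Rightarrow> (complex \<times> complex) set" where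
  "arc_pairs g =
     {(arc_point g m s, arc_point g (m + 2) (1 - s)) | m s.
        (\<exists>i<g. m = 4 * i \<or> m = 4 * i + 1) \<and> 0 \<le> s \<and> s \<le> 1}"

definition gluing :: "nat \<Rightarrow> (complex \<times> complex) set" where
  "gluing g = Id_on (cball 0 1) \<union> arc_pairs g \<union> (arc_pairs g)\<inverse>"

definition surface :: "nat \<Rightarrow> complex set topology" where
  "surface g = quotient_topology disc (\<lambda>z. gluing g `` {z})"

text \<open>The disc embedded in the surface is the image of the concentric disc of radius \<open>1/2\<close>,
  on which no points are identified.\<close>

definition disc_embedding :: "nat \<Rightarrow> complex \<Rightarrow> complex set" where
  "disc_embedding g z = gluing g `` {z / 2}"

definition punctured_disc :: "complex set \<Rightarrow> complex topology" where
  "punctured_disc Z = subtopology disc (- Z)"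

definition punctured_surface :: "nat \<Rightarrow> complex set \<Rightarrow> complex set topology" where
  "punctured_surface g Z = subtopology (surface g) (- (disc_embedding g ` Z))"

lemma arc_point_inj:
  assumes "m < 4 * g" "m' < 4 * g" "0 \<le> s" "s \<le> 1" "0 \<le> s'" "s' \<le> 1"
    and eq: "arc_point g m s = arc_point g m' s'"
  shows "m = m'" "s = s'"
proof -
  have g: "real g > 0" using assms(1) by simp
  have range: "0 \<le> pi * (2 * real n + t) / (8 * real g) \<and> pi * (2 * real n + t) / (8 * real g) \<le> pi"
    if "n < 4 * g" "0 \<le> t" "t \<le> 1" for n t
  proof -
    have "real n + 1 \<le> 4 * real g" using that(1) by linarith
    then have "2 * real n + t \<le> 8 * real g" using that(3) by linarith
    then have "pi * (2 * real n + t) \<le> pi * (8 * real g)" by (intro mult_left_mono) auto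
    then show ?thesis using that g by (auto simp: divide_le_eq)
  qed
  have "cos (pi * (2 * real m + s) / (8 * real g)) = cos (pi * (2 * real m' + s') / (8 * real g))"
    using arg_cong[OF eq, of Re] by (simp add: arc_point_def)
  then have "pi * (2 * real m + s) / (8 * real g) = pi * (2 * real m' + s') / (8 * real g)"
    using cos_inj_pi range[OF assms(1,3,4)] range[OF assms(2,5,6)] by blast
  then have *: "2 * real m + s = 2 * real m' + s'" using g by simp
  then have "\<not> m < m'" "\<not> m' < m"
    using assms(3-6) by (linarith, linarith)
  then show "m = m'" by simp
  with * show "s = s'" by simp
qed

lemma equiv_gluing: "equiv (cball 0 1) (gluing g)"
proof -
  let ?R = "arc_pairs g"
  have pairE: "\<exists>m s. x = arc_point g m s \<and> y = arc_point g (m + 2) (1 - s)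
      \<and> m mod 4 < 2 \<and> m + 2 < 4 * g \<and> 0 \<le> s \<and> s \<le> 1" if "(x, y) \<in> ?R" for x y
  proof -
    from that obtain m s i where *: "x = arc_point g m s" "y = arc_point g (m + 2) (1 - s)"
      "i < g" "m = 4 * i \<or> m = 4 * i + 1" "0 \<le> s" "s \<le> 1"
      unfolding arc_pairs_def by blast
    then have "m mod 4 < 2" "m + 2 < 4 * g" by auto
    with * show ?thesis by blast
  qed
  have inj1: "y = y'" if xy: "(x, y) \<in> ?R" and xy': "(x, y') \<in> ?R" for x y y'
  proof -
    obtain m s where 1: "x = arc_point g m s" "y = arc_point g (m + 2) (1 - s)"
      "m + 2 < 4 * g" "0 \<le> s" "s \<le> 1"
      using pairE[OF xy] by blast
    obtain m' s' where 2: "x = arc_point g m' s'" "y' = arc_point g (m' + 2) (1 - s')"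
      "m' + 2 < 4 * g" "0 \<le> s'" "s' \<le> 1"
      using pairE[OF xy'] by blast
    have "m = m'" "s = s'" using arc_point_inj[of m g m' s s'] 1 2 by simp_all
    with 1 2 show ?thesis by simp
  qed
  have inj2: "x = x'" if xy: "(x, y) \<in> ?R" and xy': "(x', y) \<in> ?R" for x x' y
  proof -
    obtain m s where 1: "x = arc_point g m s" "y = arc_point g (m + 2) (1 - s)"
      "m + 2 < 4 * g" "0 \<le> s" "s \<le> 1"
      using pairE[OF xy] by blast
    obtain m' s' where 2: "x' = arc_point g m' s'" "y = arc_point g (m' + 2) (1 - s')"
      "m' + 2 < 4 * g" "0 \<le> s'" "s' \<le> 1"
      using pairE[OF xy'] by blast
    have "m + 2 = m' + 2" "1 - s = 1 - s'"
      using arc_point_inj[of "m + 2" g "m' + 2" "1 - s" "1 - s'"] 1 2 by simp_all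
    with 1 2 show ?thesis by simp
  qed
  have no_comp: False if xy: "(x, y) \<in> ?R" and yz: "(y, z) \<in> ?R" for x y z
  proof -
    obtain m s where 1: "y = arc_point g (m + 2) (1 - s)"
      "m mod 4 < 2" "m + 2 < 4 * g" "0 \<le> s" "s \<le> 1"
      using pairE[OF xy] by blast
    obtain m' s' where 2: "y = arc_point g m' s'"
      "m' mod 4 < 2" "m' + 2 < 4 * g" "0 \<le> s'" "s' \<le> 1"
      using pairE[OF yz] by blast
    have "m + 2 = m'"
      using arc_point_inj(1)[of "m + 2" g m' "1 - s" s'] 1 2 by simp
    then show False using 1(2) 2(2) by presburger
  qed
  have sub: "?R \<subseteq> cball 0 1 \<times> cball 0 1"
    unfolding arc_pairs_def arc_point_def by auto
  show ?thesis
  proof (intro equivI)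
    show "gluing g \<subseteq> cball 0 1 \<times> cball 0 1" using sub by (auto simp: gluing_def)
    show "refl_on (cball 0 1) (gluing g)" by (auto simp: refl_on_def gluing_def)
    show "sym (gluing g)" by (auto simp: sym_def gluing_def)
    show "trans (gluing g)"
    proof (rule transI)
      have iff: "(x, y) \<in> gluing g \<longleftrightarrow> x = y \<and> x \<in> cball 0 1 \<or> (x, y) \<in> ?R \<or> (y, x) \<in> ?R" for x y
        unfolding gluing_def by blast
      have cb: "x \<in> cball 0 1 \<and> y \<in> cball 0 1" if "(x, y) \<in> ?R" for x y
        using that sub by blast
      fix x y z assume "(x, y) \<in> gluing g" "(y, z) \<in> gluing g"
      then show "(x, z) \<in> gluing g"
        unfolding iff using inj1[of y x z] inj2[of x y z] no_comp[of x y z] no_comp[of z y x]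
          cb[of x y] cb[of y x] by blast
    qed
  qed
qed

end

theory Submission
  imports Defs "HOL-Complex_Analysis.Winding_Numbers"
begin

text \<open>On the surface take two closed curves \<open>a\<close> and \<open>b\<close>, chords of the glued disc, which meet in a
  single point and avoid the embedded disc. Moving one strand along \<open>b\<close> and another along \<open>a\<close>
  maps the square \<open>[0,1]\<^sup>2\<close> minus one point to the configuration space; its boundary is the
  commutator of the two motions. Shrinking the boundary towards the missing point and
  transporting the result into the disc along a path, one sees that this commutator is freely homotopic
  to a full twist of the two strands inside the disc. The twist therefore dies in every abelian quotient of
  the surface braid group. In the disc braid group it does not: the winding number around \<open>0\<close> of a
  product of differences \<open>c i - c j\<close>, taken over a set of index pairs stable under the permutations, is a
  homomorphism to an abelian group, and it is nonzero on the twist.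

  With a single strand, the surface retracts onto the embedded disc compatibly with the punctures, so
  the inclusion has a left inverse on fundamental groups and hence on abelianizations.\<close>

section \<open>The fundamental groupoid of an abstract topological space\<close>

text \<open>Every homomorphism carries \<open>Gamma2\<close> into \<open>Gamma2\<close>, change of
  base point included. So only membership in the commutator subgroup is followed, and a free
  homotopy serves as well as a based one: the loop may leave its base point and travel into the
  embedded disc. The winding of the twist is never computed. On each side of the square the
  difference of the two strands turns round \<open>0\<close> by a positive angle, and positivity
  survives summation. Negating a difference does not change its winding, so the pairs
  \<open>(i, j)\<close> and \<open>(j, i)\<close> reinforce each other instead of cancelling. The
  constants come from the model of the surface: the embedded disc has radius \<open>1/2\<close>, and
  the corners used are at most \<open>pi / 4\<close> apart, so that the chords stay at distance more
  than \<open>1/2\<close> from the centre. Positions in the disc appear halved in the glued disc,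
  whence the factors \<open>2\<close>. The retraction identifies many points, so it acts on
  configurations only when there is a single strand and no two points have to stay distinct.\<close>

definition path_eq :: "'a topology \<Rightarrow> 'a \<Rightarrow> 'a \<Rightarrow> (real \<Rightarrow> 'a) \<Rightarrow> (real \<Rightarrow> 'a) \<Rightarrow> bool" where
  "path_eq X x y = homotopic_with (\<lambda>h. h 0 = x \<and> h 1 = y) (top_of_set {0..1}) X"

definition rev_path :: "(real \<Rightarrow> 'a) \<Rightarrow> real \<Rightarrow> 'a" where
  "rev_path \<gamma> = (\<lambda>t. \<gamma> (1 - t))"

lemma rev_path_ends [simp]: "rev_path \<gamma> 0 = \<gamma> 1" "rev_path \<gamma> 1 = \<gamma> 0"
  by (simp_all add: rev_path_def)

lemma path_eq_refl: "pathin X \<gamma> \<Longrightarrow> \<gamma> 0 = x \<Longrightarrow> \<gamma> 1 = y \<Longrightarrow> path_eq X x y \<gamma> \<gamma>"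
  by (simp add: path_eq_def pathin_def)

lemma path_eq_sym: "path_eq X x y \<gamma> \<delta> \<Longrightarrow> path_eq X x y \<delta> \<gamma>"
  unfolding path_eq_def by (rule homotopic_with_symD)

lemma path_eq_trans [trans]:
  "path_eq X x y \<gamma> \<delta> \<Longrightarrow> path_eq X x y \<delta> \<epsilon> \<Longrightarrow> path_eq X x y \<gamma> \<epsilon>"
  unfolding path_eq_def by (rule homotopic_with_trans)

lemma path_eqD:
  assumes "path_eq X x y \<gamma> \<delta>"
  shows "pathin X \<gamma>" "\<gamma> 0 = x" "\<gamma> 1 = y" "pathin X \<delta>" "\<delta> 0 = x" "\<delta> 1 = y"
  using homotopic_with_imp_continuous_maps[OF assms[unfolded path_eq_def]]
    homotopic_with_imp_property[OF assms[unfolded path_eq_def]]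
  by (auto simp: pathin_def)

lemma path_eq_cong:
  assumes "path_eq X x y \<gamma> \<delta>"
    and "\<And>t. 0 \<le> t \<Longrightarrow> t \<le> 1 \<Longrightarrow> \<gamma>' t = \<gamma> t" and "\<And>t. 0 \<le> t \<Longrightarrow> t \<le> 1 \<Longrightarrow> \<delta>' t = \<delta> t"
  shows "path_eq X x y \<gamma>' \<delta>'"
  using assms(1) unfolding path_eq_def
  by (rule homotopic_with_eq) (use assms(2,3) in auto)

lemma path_eq_compose:
  assumes "path_eq X x y \<gamma> \<delta>" and "continuous_map X Y f"
  shows "path_eq Y (f x) (f y) (f \<circ> \<gamma>) (f \<circ> \<delta>)"
  using assms unfolding path_eq_def
  by (auto intro: homotopic_with_compose_continuous_map_left)

text \<open>A straight-line homotopy inside the convex set \<open>S\<close>, pushed forward by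
  \<open>K\<close>. With \<open>S\<close> an interval and \<open>K\<close> a path it gives
  reparametrization and the cancellation of a path against its reverse; with \<open>S\<close> the
  unit square it compares the sides of a free homotopy.\<close>

lemma path_eq_convex:
  fixes p q :: "real \<Rightarrow> 'b::real_normed_vector"
  assumes K: "continuous_map (top_of_set S) X K" and S: "convex S"
    and p: "path p" "path_image p \<subseteq> S" and q: "path q" "path_image q \<subseteq> S"
    and ends: "p 0 = q 0" "p 1 = q 1"
  shows "path_eq X (K (p 0)) (K (p 1)) (K \<circ> p) (K \<circ> q)"
proof -
  have "closed_segment (p t) (q t) \<subseteq> S" if "t \<in> {0..1}" for t
    using p q that S by (intro closed_segment_subset) (auto simp: path_image_def)
  then have "homotopic_paths S p q"
    using p q ends by (intro homotopic_paths_linear) (auto simp: pathstart_def pathfinish_def)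
  then have "homotopic_with (\<lambda>r. pathstart r = pathstart p \<and> pathfinish r = pathfinish p)
      (top_of_set {0..1}) (top_of_set S) p q"
    by (simp add: homotopic_paths_def)
  then show ?thesis unfolding path_eq_def
    by (rule homotopic_with_compose_continuous_map_left[OF _ K])
      (auto simp: pathstart_def pathfinish_def)
qed

lemma path_eq_reparam:
  assumes \<gamma>: "pathin X \<gamma>" and \<phi>: "path \<phi>" "path_image \<phi> \<subseteq> {0..1}" "\<phi> 0 = 0" "\<phi> 1 = 1"
  shows "path_eq X (\<gamma> 0) (\<gamma> 1) (\<gamma> \<circ> \<phi>) \<gamma>"
  using path_eq_convex[OF \<gamma>[unfolded pathin_def], of \<phi> id] \<phi> by (auto simp: path_def path_image_def)

lemma join_compose: "f \<circ> join \<gamma> \<delta> = join (f \<circ> \<gamma>) (f \<circ> \<delta>)"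
  by (auto simp: join_def)

lemma join_eq_joinpaths: "join p q = p +++ q"
  by (simp add: join_def joinpaths_def)

lemma join_ends [simp]: "join \<gamma> \<delta> 0 = \<gamma> 0" "join \<gamma> \<delta> 1 = \<delta> 1"
  by (simp_all add: join_def)

lemma path_eq_join:
  assumes 1: "path_eq X x y \<gamma> \<gamma>'" and 2: "path_eq X y z \<delta> \<delta>'"
  shows "path_eq X x z (join \<gamma> \<delta>) (join \<gamma>' \<delta>')"
proof -
  let ?I = "top_of_set {0..1::real}"
  obtain h where h: "continuous_map (prod_topology ?I ?I) X h" "\<And>t. h (0, t) = \<gamma> t"
    "\<And>t. h (1, t) = \<gamma>' t" "\<And>s. s \<in> {0..1} \<Longrightarrow> h (s, 0) = x \<and> h (s, 1) = y"
    using 1 unfolding path_eq_def homotopic_with_def by blast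
  obtain k where k: "continuous_map (prod_topology ?I ?I) X k" "\<And>t. k (0, t) = \<delta> t"
    "\<And>t. k (1, t) = \<delta>' t" "\<And>s. s \<in> {0..1} \<Longrightarrow> k (s, 0) = y \<and> k (s, 1) = z"
    using 2 unfolding path_eq_def homotopic_with_def by blast
  let ?H = "\<lambda>u. if snd u \<le> 1/2 then (h \<circ> (\<lambda>u. (fst u, 2 * snd u))) u
    else (k \<circ> (\<lambda>u. (fst u, 2 * snd u - 1))) u"
  have eqI: "prod_topology ?I ?I = top_of_set ({0..1} \<times> {0..1})"
    by (simp add: prod_topology_subtopology_eu)
  have "continuous_map (prod_topology ?I ?I) X ?H"
  proof (rule continuous_map_cases_le)
    show "continuous_map (prod_topology ?I ?I) euclideanreal snd"
      unfolding eqI by (auto intro!: continuous_intros)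
    show "continuous_map (prod_topology ?I ?I) euclideanreal (\<lambda>u. 1/2)"
      by simp
    show "continuous_map (subtopology (prod_topology ?I ?I)
        {u \<in> topspace (prod_topology ?I ?I). snd u \<le> 1/2}) X (h \<circ> (\<lambda>u. (fst u, 2 * snd u)))"
      by (rule continuous_map_compose[OF _ h(1)])
        (auto simp: eqI subtopology_subtopology intro!: continuous_intros)
    show "continuous_map (subtopology (prod_topology ?I ?I)
        {u \<in> topspace (prod_topology ?I ?I). 1/2 \<le> snd u}) X (k \<circ> (\<lambda>u. (fst u, 2 * snd u - 1)))"
      by (rule continuous_map_compose[OF _ k(1)])
        (auto simp: eqI subtopology_subtopology intro!: continuous_intros)
    \<comment> \<open>Both homotopies fix their end points, so on the common line each of them is
      constantly \<open>y\<close>.\<close>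
    show "(h \<circ> (\<lambda>u. (fst u, 2 * snd u))) u = (k \<circ> (\<lambda>u. (fst u, 2 * snd u - 1))) u"
      if "u \<in> topspace (prod_topology ?I ?I)" "snd u = 1/2" for u
    proof -
      have "2 * snd u = 1" "2 * snd u - 1 = 0" "fst u \<in> {0..1}"
        using that by auto
      then show ?thesis
        using h(4)[of "fst u"] k(4)[of "fst u"] by (simp del: atLeastAtMost_iff)
    qed
  qed
  then show ?thesis
    unfolding path_eq_def homotopic_with_def
    by (intro exI[of _ ?H]) (use h k in \<open>auto simp: join_def\<close>)
qed

lemma pathin_join:
  assumes "pathin X \<gamma>" "pathin X \<delta>" "\<gamma> 1 = \<delta> 0"
  shows "pathin X (join \<gamma> \<delta>)"
  by (rule path_eqD(1), rule path_eq_join[OF path_eq_refl path_eq_refl]) (auto simp: assms)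

lemma pathin_reparam:
  assumes \<gamma>: "pathin X \<gamma>" and "path \<phi>" "path_image \<phi> \<subseteq> {0..1}"
  shows "pathin X (\<gamma> \<circ> \<phi>)"
  using path_eqD(1)[OF path_eq_convex[OF \<gamma>[unfolded pathin_def], of \<phi> \<phi>]] assms by simp

lemma pathin_rev: "pathin X \<gamma> \<Longrightarrow> pathin X (rev_path \<gamma>)"
  using pathin_reparam[of X \<gamma> "\<lambda>t. 1 - t"]
  by (simp add: rev_path_def path_def image_subset_iff path_image_def o_def continuous_on_op_minus)

lemma path_eq_assoc:
  assumes "pathin X \<gamma>" "pathin X \<delta>" "pathin X \<epsilon>" "\<gamma> 1 = \<delta> 0" "\<delta> 1 = \<epsilon> 0"
  shows "path_eq X (\<gamma> 0) (\<epsilon> 1) (join (join \<gamma> \<delta>) \<epsilon>) (join \<gamma> (join \<delta> \<epsilon>))"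
proof -
  \<comment> \<open>The piecewise linear map taking \<open>0, 1/4, 1/2, 1\<close> to
    \<open>0, 1/2, 3/4, 1\<close>, that is, the break points of the left bracketing to those of the
    right one.\<close>
  let ?\<phi> = "\<lambda>t::real. if t \<le> 1/2 then (if t \<le> 1/4 then 2 * t else t + 1/4) else (t + 1) / 2"
  have "path ?\<phi>"
    unfolding path_def by (intro continuous_on_cases_le continuous_intros) auto
  then have "path_eq X (join \<gamma> (join \<delta> \<epsilon>) 0) (join \<gamma> (join \<delta> \<epsilon>) 1)
      (join \<gamma> (join \<delta> \<epsilon>) \<circ> ?\<phi>) (join \<gamma> (join \<delta> \<epsilon>))"
    using assms by (intro path_eq_reparam pathin_join) (auto simp: path_image_def)
  then show ?thesis
    unfolding join_ends by (rule path_eq_cong)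
      (use assms in \<open>auto simp: join_def field_simps intro!: arg_cong[of _ _ \<delta>] arg_cong[of _ _ \<epsilon>]\<close>)
qed

lemma path_eq_const_join:
  assumes "pathin X \<gamma>"
  shows "path_eq X (\<gamma> 0) (\<gamma> 1) (join (\<lambda>_. \<gamma> 0) \<gamma>) \<gamma>"
proof -
  let ?\<phi> = "\<lambda>t::real. if t \<le> 1/2 then 0 else 2 * t - 1"
  have "path ?\<phi>"
    unfolding path_def by (intro continuous_on_cases_le continuous_intros) auto
  then have "path_eq X (\<gamma> 0) (\<gamma> 1) (\<gamma> \<circ> ?\<phi>) \<gamma>"
    using assms by (intro path_eq_reparam) (auto simp: path_image_def)
  then show ?thesis
    by (rule path_eq_cong) (auto simp: join_def)
qed

lemma path_eq_rev_join:
  assumes "pathin X \<gamma>"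
  shows "path_eq X (\<gamma> 1) (\<gamma> 1) (join (rev_path \<gamma>) \<gamma>) (\<lambda>_. \<gamma> 1)"
proof -
  \<comment> \<open>The parameter runs from \<open>1\<close> to \<open>0\<close> and back to
    \<open>1\<close>; inside the interval it is pulled straight to the constant
    \<open>1\<close>.\<close>
  let ?\<phi> = "\<lambda>t::real. if t \<le> 1/2 then 1 - 2 * t else 2 * t - 1"
  have \<phi>: "path ?\<phi>"
    unfolding path_def by (intro continuous_on_cases_le continuous_intros) auto
  have "path_eq X (\<gamma> (?\<phi> 0)) (\<gamma> (?\<phi> 1)) (\<gamma> \<circ> ?\<phi>) (\<gamma> \<circ> (\<lambda>_. 1))"
    by (intro path_eq_convex[OF assms[unfolded pathin_def]] \<phi>)
      (auto simp: path_image_def path_def intro!: continuous_intros)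
  then have "path_eq X (\<gamma> 1) (\<gamma> 1) (\<gamma> \<circ> ?\<phi>) (\<gamma> \<circ> (\<lambda>_. 1))"
    by simp
  then show ?thesis
    by (rule path_eq_cong) (auto simp: join_def rev_path_def)
qed

section \<open>The fundamental group\<close>

lemma loop_class_path_eq: "loop_class X x \<gamma> = {\<delta>. path_eq X x x \<gamma> \<delta>}"
  by (simp add: loop_class_def path_eq_def)

lemma loops_path_eq: "\<gamma> \<in> loops X x \<longleftrightarrow> path_eq X x x \<gamma> \<gamma>"
  using path_eq_refl path_eqD by (fastforce simp: loops_def)

lemma loop_class_eq_iff:
  assumes "\<gamma> \<in> loops X x"
  shows "loop_class X x \<gamma> = loop_class X x \<delta> \<longleftrightarrow> path_eq X x x \<gamma> \<delta>"
proof
  assume "loop_class X x \<gamma> = loop_class X x \<delta>"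
  moreover have "\<gamma> \<in> loop_class X x \<gamma>"
    using assms by (simp add: loop_class_path_eq loops_path_eq)
  ultimately show "path_eq X x x \<gamma> \<delta>"
    by (metis loop_class_path_eq mem_Collect_eq path_eq_sym)
next
  assume "path_eq X x x \<gamma> \<delta>"
  then show "loop_class X x \<gamma> = loop_class X x \<delta>"
    unfolding loop_class_path_eq by (blast intro: path_eq_trans path_eq_sym)
qed

lemma loop_class_eqI: "path_eq X x x \<gamma> \<delta> \<Longrightarrow> loop_class X x \<gamma> = loop_class X x \<delta>"
  using loop_class_eq_iff[of \<gamma> X x \<delta>] path_eqD[of X x x \<gamma> \<delta>] by (simp add: loops_def)

lemma loop_class_carrier: "\<gamma> \<in> loops X x \<Longrightarrow> loop_class X x \<gamma> \<in> carrier (pi1 X x)"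
  by (simp add: pi1_def)

lemma pi1_carrierE:
  assumes "K \<in> carrier (pi1 X x)"
  obtains \<gamma> where "\<gamma> \<in> loops X x" "K = loop_class X x \<gamma>"
  using assms by (auto simp: pi1_def)

lemma join_loops: "\<gamma> \<in> loops X x \<Longrightarrow> \<delta> \<in> loops X x \<Longrightarrow> join \<gamma> \<delta> \<in> loops X x"
  unfolding loops_path_eq by (rule path_eq_join)

lemma pi1_mult:
  assumes "\<gamma> \<in> loops X x" "\<delta> \<in> loops X x"
  shows "loop_class X x \<gamma> \<otimes>\<^bsub>pi1 X x\<^esub> loop_class X x \<delta> = loop_class X x (join \<gamma> \<delta>)"
proof -
  have "loop_class X x (join \<gamma>' \<delta>') = loop_class X x (join \<gamma> \<delta>)"
    if "\<gamma>' \<in> loop_class X x \<gamma>" "\<delta>' \<in> loop_class X x \<delta>" for \<gamma>' \<delta>'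
    using that
    by (intro loop_class_eqI path_eq_join[OF path_eq_sym path_eq_sym])
      (auto simp: loop_class_path_eq)
  moreover have "\<gamma> \<in> loop_class X x \<gamma>" "\<delta> \<in> loop_class X x \<delta>"
    using assms by (auto simp: loop_class_path_eq loops_path_eq)
  ultimately show ?thesis
    unfolding pi1_def monoid.simps by blast
qed

lemma pi1_one: "\<one>\<^bsub>pi1 X x\<^esub> = loop_class X x (\<lambda>_. x)"
  by (simp add: pi1_def)

lemma rev_loops: "\<gamma> \<in> loops X x \<Longrightarrow> rev_path \<gamma> \<in> loops X x"
  by (auto simp: loops_def intro: pathin_rev)

lemma pi1_rev_mult:
  assumes "\<gamma> \<in> loops X x"
  shows "loop_class X x (rev_path \<gamma>) \<otimes>\<^bsub>pi1 X x\<^esub> loop_class X x \<gamma> = \<one>\<^bsub>pi1 X x\<^esub>"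
  unfolding pi1_mult[OF rev_loops[OF assms] assms] pi1_one
  using path_eq_rev_join[of X \<gamma>] assms by (intro loop_class_eqI) (auto simp: loops_def)

lemma const_loop: "x \<in> topspace X \<Longrightarrow> (\<lambda>_. x) \<in> loops X x"
  by (simp add: loops_def)

lemma group_pi1:
  assumes "x \<in> topspace X"
  shows "group (pi1 X x)"
proof (rule groupI)
  show "\<one>\<^bsub>pi1 X x\<^esub> \<in> carrier (pi1 X x)"
    using loop_class_carrier[OF const_loop[OF assms]] by (simp add: pi1_one)
next
  fix K L assume "K \<in> carrier (pi1 X x)" "L \<in> carrier (pi1 X x)"
  then show "K \<otimes>\<^bsub>pi1 X x\<^esub> L \<in> carrier (pi1 X x)"
    by (elim pi1_carrierE) (simp add: pi1_mult join_loops loop_class_carrier)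
next
  fix K L M assume "K \<in> carrier (pi1 X x)" "L \<in> carrier (pi1 X x)" "M \<in> carrier (pi1 X x)"
  then obtain \<gamma> \<delta> \<epsilon> where *: "\<gamma> \<in> loops X x" "K = loop_class X x \<gamma>"
    "\<delta> \<in> loops X x" "L = loop_class X x \<delta>" "\<epsilon> \<in> loops X x" "M = loop_class X x \<epsilon>"
    by (metis pi1_carrierE)
  have eq: "path_eq X x x (join (join \<gamma> \<delta>) \<epsilon>) (join \<gamma> (join \<delta> \<epsilon>))"
    using path_eq_assoc[of X \<gamma> \<delta> \<epsilon>] * by (auto simp: loops_def)
  then show "K \<otimes>\<^bsub>pi1 X x\<^esub> L \<otimes>\<^bsub>pi1 X x\<^esub> M = K \<otimes>\<^bsub>pi1 X x\<^esub> (L \<otimes>\<^bsub>pi1 X x\<^esub> M)"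
    using * loop_class_eqI[OF eq] by (simp add: pi1_mult join_loops)
next
  fix K assume "K \<in> carrier (pi1 X x)"
  then obtain \<gamma> where *: "\<gamma> \<in> loops X x" "K = loop_class X x \<gamma>"
    by (rule pi1_carrierE)
  have eq: "path_eq X x x (join (\<lambda>_. x) \<gamma>) \<gamma>"
    using path_eq_const_join[of X \<gamma>] * by (auto simp: loops_def)
  then show "\<one>\<^bsub>pi1 X x\<^esub> \<otimes>\<^bsub>pi1 X x\<^esub> K = K"
    using * assms loop_class_eqI[OF eq] by (simp add: pi1_one pi1_mult const_loop)
  show "\<exists>L\<in>carrier (pi1 X x). L \<otimes>\<^bsub>pi1 X x\<^esub> K = \<one>\<^bsub>pi1 X x\<^esub>"
    using pi1_rev_mult[OF *(1)] loop_class_carrier[OF rev_loops[OF *(1)]] *(2) by blast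
qed

lemma pi1_inv:
  assumes "\<gamma> \<in> loops X x"
  shows "inv\<^bsub>pi1 X x\<^esub> loop_class X x \<gamma> = loop_class X x (rev_path \<gamma>)"
proof -
  have "x \<in> topspace X"
    using assms path_start_in_topspace[of X \<gamma>] by (simp add: loops_def)
  then interpret group "pi1 X x"
    by (rule group_pi1)
  show ?thesis
    by (rule inv_equality) (simp_all add: assms pi1_rev_mult loop_class_carrier rev_loops)
qed

lemma compose_loops:
  "\<gamma> \<in> loops X x \<Longrightarrow> continuous_map X Y f \<Longrightarrow> f x = y \<Longrightarrow> f \<circ> \<gamma> \<in> loops Y y"
  by (auto simp: loops_def intro: pathin_compose)

lemma pi1_map_class:
  assumes \<gamma>: "\<gamma> \<in> loops X x" and f: "continuous_map X Y f" "f x = y"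
  shows "pi1_map Y y f (loop_class X x \<gamma>) = loop_class Y y (f \<circ> \<gamma>)"
proof -
  have "loop_class Y y (f \<circ> \<delta>) = loop_class Y y (f \<circ> \<gamma>)" if "\<delta> \<in> loop_class X x \<gamma>" for \<delta>
    using that path_eq_compose[OF path_eq_sym f(1), of x x \<gamma> \<delta>] f(2)
    by (intro loop_class_eqI) (auto simp: loop_class_path_eq)
  moreover have "\<gamma> \<in> loop_class X x \<gamma>"
    using \<gamma> by (auto simp: loop_class_path_eq loops_path_eq)
  ultimately show ?thesis
    unfolding pi1_map_def by blast
qed

lemma pi1_map_hom:
  assumes f: "continuous_map X Y f" "f x = y"
  shows "pi1_map Y y f \<in> hom (pi1 X x) (pi1 Y y)"
proof (rule homI)
  fix K assume "K \<in> carrier (pi1 X x)"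
  then show "pi1_map Y y f K \<in> carrier (pi1 Y y)"
    by (metis pi1_carrierE pi1_map_class[OF _ f] loop_class_carrier compose_loops[OF _ f])
next
  fix K L assume "K \<in> carrier (pi1 X x)" "L \<in> carrier (pi1 X x)"
  then obtain \<gamma> \<delta> where *: "\<gamma> \<in> loops X x" "K = loop_class X x \<gamma>"
    "\<delta> \<in> loops X x" "L = loop_class X x \<delta>"
    by (metis pi1_carrierE)
  then show "pi1_map Y y f (K \<otimes>\<^bsub>pi1 X x\<^esub> L) = pi1_map Y y f K \<otimes>\<^bsub>pi1 Y y\<^esub> pi1_map Y y f L"
    by (simp add: pi1_map_class[OF _ f] pi1_mult join_loops compose_loops[OF _ f] join_compose)
qed

section \<open>Homomorphisms and commutator subgroups\<close>

lemma hom_derived: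
  assumes G: "group G" and H: "group H" and f: "f \<in> hom G H" and x: "x \<in> Gamma2 G"
  shows "f x \<in> Gamma2 H"
proof -
  interpret f: group_hom G H f
    using G H f by (simp add: group_hom_def group_hom_axioms_def)
  have D: "derived_set G (carrier G) \<subseteq> carrier G"
    by (intro f.G.derived_set_in_carrier) auto
  have "f ` Gamma2 G = generate H (f ` derived_set G (carrier G))"
    unfolding derived_def using f.generate_img[OF D] by simp
  also have "\<dots> \<subseteq> Gamma2 H"
    unfolding derived_def
  proof (rule f.H.mono_generate, rule image_subsetI)
    fix z assume "z \<in> derived_set G (carrier G)"
    then obtain a b where ab: "a \<in> carrier G" "b \<in> carrier G"
      "z = a \<otimes>\<^bsub>G\<^esub> b \<otimes>\<^bsub>G\<^esub> inv\<^bsub>G\<^esub> a \<otimes>\<^bsub>G\<^esub> inv\<^bsub>G\<^esub> b"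
      by auto
    then have "f z = f a \<otimes>\<^bsub>H\<^esub> f b \<otimes>\<^bsub>H\<^esub> inv\<^bsub>H\<^esub> f a \<otimes>\<^bsub>H\<^esub> inv\<^bsub>H\<^esub> f b"
      by simp
    then show "f z \<in> derived_set H (carrier H)"
      using ab f.hom_closed by blast
  qed
  finally show ?thesis
    using x by blast
qed

lemma hom_comm_group_derived:
  assumes "group G" and A: "comm_group A" and "f \<in> hom G A" and "x \<in> Gamma2 G"
  shows "f x = \<one>\<^bsub>A\<^esub>"
  using hom_derived[OF assms(1) _ assms(3,4)] comm_group.derived_eq_singleton[OF A, of "carrier A"]
    comm_group.axioms(2)[OF A] by auto

lemma ab_proj_eq_iff:
  assumes "group G" "x \<in> carrier G" "y \<in> carrier G"
  shows "ab_proj G x = ab_proj G y \<longleftrightarrow> x \<otimes>\<^bsub>G\<^esub> inv\<^bsub>G\<^esub> y \<in> Gamma2 G"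
proof -
  interpret group G by fact
  have S: "subgroup (Gamma2 G) G"
    by (rule derived_is_subgroup) simp
  show ?thesis
    unfolding ab_proj_def
  proof
    assume "Gamma2 G #>\<^bsub>G\<^esub> x = Gamma2 G #>\<^bsub>G\<^esub> y"
    then have "x \<in> Gamma2 G #>\<^bsub>G\<^esub> y"
      using rcos_self[OF assms(2) S] by blast
    then show "x \<otimes>\<^bsub>G\<^esub> inv\<^bsub>G\<^esub> y \<in> Gamma2 G"
      using subgroup.rcos_module_imp[OF S] assms is_group by auto
  next
    assume "x \<otimes>\<^bsub>G\<^esub> inv\<^bsub>G\<^esub> y \<in> Gamma2 G"
    then have "x \<in> Gamma2 G #>\<^bsub>G\<^esub> y"
      using subgroup.rcos_module_rev[OF S] assms is_group by auto
    then show "Gamma2 G #>\<^bsub>G\<^esub> x = Gamma2 G #>\<^bsub>G\<^esub> y"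
      using repr_independence[OF _ assms(3) S] by simp
  qed
qed

lemma ab_proj_carrier: "x \<in> carrier G \<Longrightarrow> ab_proj G x \<in> carrier (abelianization G)"
  by (auto simp: ab_proj_def FactGroup_def RCOSETS_def)

lemma abelianization_carrierE:
  assumes "C \<in> carrier (abelianization G)"
  obtains x where "x \<in> carrier G" "C = ab_proj G x"
  using assms by (auto simp: ab_proj_def FactGroup_def RCOSETS_def)

lemma ab_map_ab_proj:
  assumes G: "group G" and H: "group H" and f: "f \<in> hom G H" and x: "x \<in> carrier G"
  shows "ab_map H f (ab_proj G x) = ab_proj H (f x)"
proof -
  interpret f: group_hom G H f
    using G H f by (simp add: group_hom_def group_hom_axioms_def)
  have S: "subgroup (Gamma2 G) G"
    by (rule f.G.derived_is_subgroup) simp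
  have "ab_proj H (f y) = ab_proj H (f x)" if "y \<in> ab_proj G x" for y
  proof -
    have y: "y \<in> carrier G" "y \<otimes>\<^bsub>G\<^esub> inv\<^bsub>G\<^esub> x \<in> Gamma2 G"
      using that x S f.G.is_group subgroup.rcos_module_imp[OF S]
        f.G.r_coset_subset_G[OF subgroup.subset[OF S] x]
      by (auto simp: ab_proj_def)
    have "f (y \<otimes>\<^bsub>G\<^esub> inv\<^bsub>G\<^esub> x) = f y \<otimes>\<^bsub>H\<^esub> inv\<^bsub>H\<^esub> f x"
      using x y by simp
    then show ?thesis
      using hom_derived[OF G H f y(2)] x y by (simp add: ab_proj_eq_iff[OF H])
  qed
  moreover have "x \<in> ab_proj G x"
    unfolding ab_proj_def by (rule f.G.rcos_self[OF x S])
  ultimately show ?thesis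
    unfolding ab_map_def by blast
qed

text \<open>The single element \<open>x\<close> decides everything: \<open>P\<close> sends
  \<open>\<iota> x\<close>, which lies in \<open>Gamma2 B'\<close>, to the unit of the abelian group
  \<open>G\<close>, so \<open>Pbar\<close> takes the same value on the distinct classes of
  \<open>x\<close> and of the unit. The induced map on abelianizations identifies the same two
  classes.\<close>

lemma abelianization_not_injective:
  assumes B: "group B" and B': "group B'" and \<iota>: "\<iota> \<in> hom B B'" and G: "comm_group G"
    and x: "x \<in> carrier B" "x \<notin> Gamma2 B" "\<iota> x \<in> Gamma2 B'"
  shows "(\<forall>P Pbar. P \<in> hom B' G \<longrightarrow> Pbar \<in> hom (abelianization B) G \<longrightarrow>
            (\<forall>x\<in>carrier B. P (\<iota> x) = Pbar (ab_proj B x)) \<longrightarrow>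
            \<not> inj_on Pbar (carrier (abelianization B))) \<and>
         \<not> inj_on (ab_map B' \<iota>) (carrier (abelianization B))"
proof -
  interpret \<iota>: group_hom B B' \<iota>
    using B B' \<iota> by (simp add: group_hom_def group_hom_axioms_def)
  have neq: "ab_proj B x \<noteq> ab_proj B \<one>\<^bsub>B\<^esub>"
    using x by (simp add: ab_proj_eq_iff[OF B])
  have carr: "ab_proj B x \<in> carrier (abelianization B)"
    "ab_proj B \<one>\<^bsub>B\<^esub> \<in> carrier (abelianization B)"
    using x(1) by (simp_all add: ab_proj_carrier)
  have "\<not> inj_on Pbar (carrier (abelianization B))"
    if "P \<in> hom B' G" "\<forall>x\<in>carrier B. P (\<iota> x) = Pbar (ab_proj B x)" for P Pbar
  proof -
    have "subgroup (Gamma2 B') B'"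
      by (rule \<iota>.H.derived_is_subgroup) simp
    then have "P (\<iota> x) = \<one>\<^bsub>G\<^esub>" "P (\<iota> \<one>\<^bsub>B\<^esub>) = \<one>\<^bsub>G\<^esub>"
      using hom_comm_group_derived[OF B' G that(1)] x(3) subgroup.one_closed by auto
    then have "Pbar (ab_proj B x) = Pbar (ab_proj B \<one>\<^bsub>B\<^esub>)"
      using that(2) x(1) by (metis \<iota>.G.one_closed)
    then show ?thesis
      using neq carr by (auto dest: inj_onD)
  qed
  moreover have "ab_map B' \<iota> (ab_proj B x) = ab_map B' \<iota> (ab_proj B \<one>\<^bsub>B\<^esub>)"
    using x by (simp add: ab_map_ab_proj[OF B B' \<iota>] ab_proj_eq_iff[OF B'])
  then have "\<not> inj_on (ab_map B' \<iota>) (carrier (abelianization B))"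
    using neq carr by (auto dest: inj_onD)
  ultimately show ?thesis
    by blast
qed

text \<open>If \<open>x\<close> and \<open>y\<close> have images that differ by an element of
  \<open>Gamma2 B'\<close>, then applying \<open>\<rho>\<close> returns \<open>x\<close> and
  \<open>y\<close> themselves, now differing by an element of \<open>Gamma2 B\<close>.\<close>

lemma ab_map_injective:
  assumes B: "group B" and B': "group B'" and \<iota>: "\<iota> \<in> hom B B'" and \<rho>: "\<rho> \<in> hom B' B"
    and id: "\<And>x. x \<in> carrier B \<Longrightarrow> \<rho> (\<iota> x) = x"
  shows "inj_on (ab_map B' \<iota>) (carrier (abelianization B))"
proof (rule inj_onI)
  interpret \<iota>: group_hom B B' \<iota>
    using B B' \<iota> by (simp add: group_hom_def group_hom_axioms_def)
  fix C D assume "C \<in> carrier (abelianization B)" "D \<in> carrier (abelianization B)"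
    and eq: "ab_map B' \<iota> C = ab_map B' \<iota> D"
  then obtain x y where xy: "x \<in> carrier B" "C = ab_proj B x" "y \<in> carrier B" "D = ab_proj B y"
    by (elim abelianization_carrierE)
  have "\<iota> (x \<otimes>\<^bsub>B\<^esub> inv\<^bsub>B\<^esub> y) \<in> Gamma2 B'"
    using eq xy by (simp add: ab_map_ab_proj[OF B B' \<iota>] ab_proj_eq_iff[OF B'])
  then have "\<rho> (\<iota> (x \<otimes>\<^bsub>B\<^esub> inv\<^bsub>B\<^esub> y)) \<in> Gamma2 B"
    by (rule hom_derived[OF B' B \<rho>])
  then have "x \<otimes>\<^bsub>B\<^esub> inv\<^bsub>B\<^esub> y \<in> Gamma2 B"
    using xy id[of "x \<otimes>\<^bsub>B\<^esub> inv\<^bsub>B\<^esub> y"] by simp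
  then show "C = D"
    using xy by (simp add: ab_proj_eq_iff[OF B])
qed

section \<open>Change of base point\<close>

definition conj_path :: "(real \<Rightarrow> 'a) \<Rightarrow> (real \<Rightarrow> 'a) \<Rightarrow> real \<Rightarrow> 'a" where
  "conj_path \<tau> \<gamma> = join (join \<tau> \<gamma>) (rev_path \<tau>)"

lemma conj_path_compose: "f \<circ> conj_path \<tau> \<gamma> = conj_path (f \<circ> \<tau>) (f \<circ> \<gamma>)"
  by (simp add: conj_path_def join_compose) (simp add: rev_path_def o_def)

lemma conj_path_ends [simp]: "conj_path \<tau> \<gamma> 0 = \<tau> 0" "conj_path \<tau> \<gamma> 1 = \<tau> 0"
  by (simp_all add: conj_path_def)

lemma path_eq_rev:
  assumes "path_eq X x y \<gamma> \<delta>"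
  shows "path_eq X y x (rev_path \<gamma>) (rev_path \<delta>)"
proof -
  have "homotopic_with (\<lambda>h. h 0 = y \<and> h 1 = x) (top_of_set {0..1}) X (\<gamma> \<circ> (\<lambda>t. 1 - t)) (\<delta> \<circ> (\<lambda>t. 1 - t))"
    using assms unfolding path_eq_def
    by (rule homotopic_with_compose_continuous_map_right) (auto intro!: continuous_intros)
  then show ?thesis
    by (simp add: path_eq_def rev_path_def o_def)
qed

lemma conj_path_loop:
  assumes "\<gamma> \<in> loops X y" "pathin X \<tau>" "\<tau> 0 = x" "\<tau> 1 = y"
  shows "conj_path \<tau> \<gamma> \<in> loops X x"
proof -
  have \<gamma>: "pathin X \<gamma>" "\<gamma> 0 = y" "\<gamma> 1 = y"
    using assms(1) by (auto simp: loops_def)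
  have "pathin X (conj_path \<tau> \<gamma>)"
    unfolding conj_path_def
    by (intro pathin_join pathin_rev \<gamma>(1) assms(2)) (simp_all add: \<gamma> assms(4))
  then show ?thesis
    by (simp add: loops_def assms(3))
qed

lemma path_eq_conj_path:
  assumes \<tau>: "pathin X \<tau>" "\<tau> 0 = x" "\<tau> 1 = y" and "path_eq X y y \<gamma> \<delta>"
  shows "path_eq X x x (conj_path \<tau> \<gamma>) (conj_path \<tau> \<delta>)"
  unfolding conj_path_def
  using path_eq_join[OF path_eq_join[OF path_eq_refl[OF \<tau>] assms(4)]
      path_eq_rev[OF path_eq_refl[OF \<tau>]]] .

text \<open>The return along \<open>\<tau>\<close> and the new departure along \<open>\<tau>\<close>
  cancel in the middle; the associativity steps serve to make these two factors adjacent. This is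
  what makes change of base point multiplicative.\<close>

lemma path_eq_conj_join:
  assumes \<tau>: "pathin X \<tau>" "\<tau> 0 = x" "\<tau> 1 = y" and \<gamma>: "\<gamma> \<in> loops X y" and \<delta>: "\<delta> \<in> loops X y"
  shows "path_eq X x x (join (conj_path \<tau> \<gamma>) (conj_path \<tau> \<delta>)) (conj_path \<tau> (join \<gamma> \<delta>))"
proof -
  let ?\<tau>' = "rev_path \<tau>" let ?A = "join \<tau> \<gamma>"
  have p: "pathin X \<gamma>" "\<gamma> 0 = y" "\<gamma> 1 = y" "pathin X \<delta>" "\<delta> 0 = y" "\<delta> 1 = y" "pathin X ?\<tau>'"
    using \<gamma> \<delta> \<tau> by (simp_all add: loops_def pathin_rev)
  have A: "pathin X ?A" "?A 0 = x" "?A 1 = y"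
    using p \<tau> by (simp_all add: pathin_join)
  have refl: "path_eq X x y ?A ?A" "path_eq X y x ?\<tau>' ?\<tau>'"
    using p A \<tau> by (simp_all add: path_eq_refl)
  have D: "pathin X (join \<delta> ?\<tau>')" "join \<delta> ?\<tau>' 0 = y" "join \<delta> ?\<tau>' 1 = x"
    using p \<tau> by (simp_all add: pathin_join)
  have cancel: "path_eq X y y (join ?\<tau>' \<tau>) (\<lambda>_. y)"
    using path_eq_rev_join[OF \<tau>(1)] \<tau> by simp
  have assoc: "path_eq X x x (join (join \<tau> \<delta>) ?\<tau>') (join \<tau> (join \<delta> ?\<tau>'))"
    "path_eq X x x (join (join ?A ?\<tau>') (join \<tau> (join \<delta> ?\<tau>'))) (join ?A (join ?\<tau>' (join \<tau> (join \<delta> ?\<tau>'))))"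
    "path_eq X y x (join (join ?\<tau>' \<tau>) (join \<delta> ?\<tau>')) (join ?\<tau>' (join \<tau> (join \<delta> ?\<tau>')))"
    "path_eq X x x (join (join ?A \<delta>) ?\<tau>') (join ?A (join \<delta> ?\<tau>'))"
    "path_eq X x y (join ?A \<delta>) (join \<tau> (join \<gamma> \<delta>))"
    using path_eq_assoc[of X \<tau> \<delta> ?\<tau>'] path_eq_assoc[of X ?A ?\<tau>' "join \<tau> (join \<delta> ?\<tau>')"]
      path_eq_assoc[of X ?\<tau>' \<tau> "join \<delta> ?\<tau>'"] path_eq_assoc[of X ?A \<delta> ?\<tau>']
      path_eq_assoc[of X \<tau> \<gamma> \<delta>] p \<tau> A D pathin_join[OF \<tau>(1) D(1)]
    by simp_all
  have unit: "path_eq X y x (join (\<lambda>_. y) (join \<delta> ?\<tau>')) (join \<delta> ?\<tau>')"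
    using path_eq_const_join[OF D(1)] D by simp
  have "path_eq X x x (join (join ?A ?\<tau>') (join (join \<tau> \<delta>) ?\<tau>'))
      (join (join ?A ?\<tau>') (join \<tau> (join \<delta> ?\<tau>')))"
    by (rule path_eq_join[OF path_eq_join[OF refl(1,2)] assoc(1)])
  also note assoc(2)
  also note path_eq_join[OF refl(1) path_eq_sym[OF assoc(3)]]
  also note path_eq_join[OF refl(1) path_eq_join[OF cancel path_eq_refl[OF D]]]
  also note path_eq_join[OF refl(1) unit]
  also note path_eq_sym[OF assoc(4)]
  also note path_eq_join[OF assoc(5) refl(2)]
  finally show ?thesis
    by (simp add: conj_path_def)
qed

text \<open>The base point is read off from the loop itself, so that the predicate can be passed
  along homotopies that move the base point.\<close>

definition commutator_loop :: "'a topology \<Rightarrow> (real \<Rightarrow> 'a) \<Rightarrow> bool" where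
  "commutator_loop X \<gamma> \<longleftrightarrow> \<gamma> \<in> loops X (\<gamma> 0) \<and> loop_class X (\<gamma> 0) \<gamma> \<in> Gamma2 (pi1 X (\<gamma> 0))"

lemma commutator_loop_path_eq:
  assumes "path_eq X x x \<gamma> \<delta>" "commutator_loop X \<gamma>"
  shows "commutator_loop X \<delta>"
proof -
  note * = path_eqD[OF assms(1)]
  have "\<delta> \<in> loops X x"
    using *(4-6) by (simp add: loops_def)
  moreover have "loop_class X x \<delta> \<in> Gamma2 (pi1 X x)"
    using assms(2) unfolding commutator_loop_def *(2) loop_class_eqI[OF assms(1)] by simp
  ultimately show ?thesis
    by (simp add: commutator_loop_def *(5))
qed

lemma commutator_loop_conj:
  assumes \<gamma>: "commutator_loop X \<gamma>" and \<tau>: "pathin X \<tau>" "\<tau> 1 = \<gamma> 0"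
  shows "commutator_loop X (conj_path \<tau> \<gamma>)"
proof -
  define x y where "x = \<tau> 0" and "y = \<gamma> 0"
  have \<tau>': "\<tau> 0 = x" "\<tau> 1 = y"
    using \<tau> by (auto simp: x_def y_def)
  have xy: "x \<in> topspace X" "y \<in> topspace X"
    using \<tau>' path_start_in_topspace[OF \<tau>(1)] path_finish_in_topspace[OF \<tau>(1)] by auto
  \<comment> \<open>Change of base point along \<open>\<tau>\<close>, lifted to classes by a union
    over representatives. By \<open>path_eq_conj_path\<close> all the sets in the union
    coincide.\<close>
  define \<Theta> where "\<Theta> K = (\<Union>\<delta>\<in>K. loop_class X x (conj_path \<tau> \<delta>))" for K
  have \<Theta>: "\<Theta> (loop_class X y \<delta>) = loop_class X x (conj_path \<tau> \<delta>)" if "\<delta> \<in> loops X y" for \<delta>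
  proof -
    have "loop_class X x (conj_path \<tau> \<epsilon>) = loop_class X x (conj_path \<tau> \<delta>)"
      if "\<epsilon> \<in> loop_class X y \<delta>" for \<epsilon>
      using that loop_class_eqI[OF path_eq_conj_path[OF \<tau>(1) \<tau>']]
      by (simp add: loop_class_path_eq)
    moreover have "\<delta> \<in> loop_class X y \<delta>"
      using that by (simp add: loop_class_path_eq loops_path_eq)
    ultimately show ?thesis
      unfolding \<Theta>_def by blast
  qed
  have hom: "\<Theta> \<in> hom (pi1 X y) (pi1 X x)"
  proof (rule homI)
    fix K assume "K \<in> carrier (pi1 X y)"
    then show "\<Theta> K \<in> carrier (pi1 X x)"
      by (elim pi1_carrierE) (simp add: \<Theta> loop_class_carrier conj_path_loop[OF _ \<tau>(1) \<tau>'])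
  next
    fix K L assume "K \<in> carrier (pi1 X y)" "L \<in> carrier (pi1 X y)"
    then obtain \<delta> \<epsilon> where *: "\<delta> \<in> loops X y" "K = loop_class X y \<delta>"
      "\<epsilon> \<in> loops X y" "L = loop_class X y \<epsilon>"
      by (metis pi1_carrierE)
    have cl: "conj_path \<tau> \<delta> \<in> loops X x" "conj_path \<tau> \<epsilon> \<in> loops X x"
      using * \<tau> \<tau>' by (auto intro: conj_path_loop)
    show "\<Theta> (K \<otimes>\<^bsub>pi1 X y\<^esub> L) = \<Theta> K \<otimes>\<^bsub>pi1 X x\<^esub> \<Theta> L"
      using * cl loop_class_eqI[OF path_eq_conj_join[OF \<tau>(1) \<tau>' *(1,3)]]
      by (simp add: pi1_mult join_loops \<Theta>)
  qed
  have l: "\<gamma> \<in> loops X y" "loop_class X y \<gamma> \<in> Gamma2 (pi1 X y)"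
    using \<gamma> unfolding commutator_loop_def y_def by blast+
  have "\<Theta> (loop_class X y \<gamma>) \<in> Gamma2 (pi1 X x)"
    by (rule hom_derived[OF group_pi1[OF xy(2)] group_pi1[OF xy(1)] hom l(2)])
  then show ?thesis
    using conj_path_loop[OF l(1) \<tau>(1) \<tau>'] unfolding commutator_loop_def conj_path_ends \<tau>'(1) \<Theta>[OF l(1)]
    by blast
qed

text \<open>In the convex square the side over \<open>0\<close> is homotopic to the way round the
  other three sides. The sides \<open>t = 0\<close> and \<open>t = 1\<close> have the same image
  under \<open>H\<close>, so this detour is the loop over \<open>1\<close> conjugated by the track
  of its base point.\<close>

lemma commutator_loop_free_homotopy:
  fixes H :: "real \<times> real \<Rightarrow> 'a"
  assumes H: "continuous_map (top_of_set ({0..1} \<times> {0..1})) X H"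
    and loop: "\<And>s. 0 \<le> s \<Longrightarrow> s \<le> 1 \<Longrightarrow> H (s, 0) = H (s, 1)"
    and comm: "commutator_loop X (\<lambda>t. H (1, t))"
  shows "commutator_loop X (\<lambda>t. H (0, t))"
proof -
  let ?S = "{0..1::real} \<times> {0..1::real}"
  let ?l = "\<lambda>t::real. (t, 0::real)" and ?m = "\<lambda>t. (1::real, t)" and ?p = "\<lambda>t. (0::real, t)"
  have lin: "path ?l" "path ?m" "path ?p" "path (\<lambda>t. (1 - t, 1::real))"
    by (auto simp: path_def intro!: continuous_intros)
  \<comment> \<open>The detour \<open>(0,0)\<close>, \<open>(1,0)\<close>, \<open>(1,1)\<close>,
    \<open>(0,1)\<close>.\<close>
  define q where "q = join (join ?l ?m) (\<lambda>t. (1 - t, 1::real))"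
  have q: "pathin (top_of_set ?S) q"
    unfolding q_def using lin
    by (intro pathin_join) (auto simp: pathin_canon_iff)
  have "path q" "path_image q \<subseteq> ?S"
    using q by (simp_all add: pathin_canon_iff path_image_def image_subset_iff_funcset)
  moreover have "q 0 = (0, 0)" "q 1 = (0, 1)"
    by (simp_all add: q_def)
  moreover have "path_image ?p \<subseteq> ?S"
    by (auto simp: path_image_def)
  ultimately have "path_eq X (H (q 0)) (H (q 1)) (H \<circ> q) (H \<circ> ?p)"
    using lin(3) by (intro path_eq_convex[OF H]) (simp_all add: convex_Times)
  moreover have "H \<circ> q = join (join (H \<circ> ?l) (H \<circ> ?m)) (H \<circ> (\<lambda>t. (1 - t, 1)))"
    by (simp add: q_def join_compose)
  moreover have "q 0 = (0, 0)" "q 1 = (0, 1)" "H (0, 1) = H (0, 0)"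
    using loop[of 0] by (auto simp: q_def)
  ultimately have eq: "path_eq X (H (0,0)) (H (0,0)) (join (join (H \<circ> ?l) (H \<circ> ?m)) (H \<circ> (\<lambda>t. (1 - t, 1)))) (H \<circ> ?p)"
    by simp
  have "path_eq X (H (0,0)) (H (0,0)) (conj_path (H \<circ> ?l) (H \<circ> ?m)) (H \<circ> ?p)"
    using eq by (rule path_eq_cong) (auto simp: conj_path_def join_def rev_path_def loop)
  moreover have "pathin X (H \<circ> ?l)"
    using lin(1) by (intro pathin_compose[OF _ H]) (auto simp: pathin_canon_iff)
  then have "commutator_loop X (conj_path (H \<circ> ?l) (H \<circ> ?m))"
    using comm by (intro commutator_loop_conj) (auto simp: o_def)
  ultimately show ?thesis
    using commutator_loop_path_eq by (fastforce simp: o_def)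
qed

lemma commutator_loop_commutator:
  assumes "\<gamma> \<in> loops X x" "\<delta> \<in> loops X x"
  shows "commutator_loop X (join (join (join \<gamma> \<delta>) (rev_path \<gamma>)) (rev_path \<delta>))" (is "commutator_loop X ?\<kappa>")
proof -
  have 0: "?\<kappa> 0 = x"
    using assms by (simp add: loops_def)
  have "?\<kappa> \<in> loops X x"
    using assms by (simp add: join_loops rev_loops)
  moreover have "loop_class X x ?\<kappa> = loop_class X x \<gamma> \<otimes>\<^bsub>pi1 X x\<^esub> loop_class X x \<delta>
      \<otimes>\<^bsub>pi1 X x\<^esub> inv\<^bsub>pi1 X x\<^esub> loop_class X x \<gamma> \<otimes>\<^bsub>pi1 X x\<^esub> inv\<^bsub>pi1 X x\<^esub> loop_class X x \<delta>"
    using assms by (simp add: pi1_mult pi1_inv join_loops rev_loops)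
  then have "loop_class X x ?\<kappa> \<in> derived_set (pi1 X x) (carrier (pi1 X x))"
    using loop_class_carrier[OF assms(1)] loop_class_carrier[OF assms(2)] by auto
  then have "loop_class X x ?\<kappa> \<in> Gamma2 (pi1 X x)"
    unfolding derived_def by (rule generate.incl)
  ultimately show ?thesis
    unfolding commutator_loop_def 0 by blast
qed

section \<open>Surfaces and maps of configuration spaces\<close>

lemma topspace_disc [simp]: "topspace disc = cball 0 1"
  by (simp add: disc_def)

lemma topspace_punctured_disc: "topspace (punctured_disc Z) = cball 0 1 - Z"
  by (auto simp: punctured_disc_def)

lemma topspace_surface: "topspace (surface g) = (\<lambda>z. gluing g `` {z}) ` cball 0 1"
  by (simp add: surface_def topspace_quotient_topology)

lemma quotient_map_surface: "quotient_map disc (surface g) (\<lambda>z. gluing g `` {z})"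
  unfolding surface_def by (rule quotient_map_quotient_topology)

lemma continuous_map_gluing: "continuous_map disc (surface g) (\<lambda>z. gluing g `` {z})"
  by (rule quotient_imp_continuous_map[OF quotient_map_surface])

lemma norm_arc_point [simp]: "cmod (arc_point g m s) = 1"
  by (simp add: arc_point_def)

lemma gluing_class_eq_iff:
  "z \<in> cball 0 1 \<Longrightarrow> w \<in> cball 0 1 \<Longrightarrow> gluing g `` {z} = gluing g `` {w} \<longleftrightarrow> (z, w) \<in> gluing g"
  by (rule eq_equiv_class_iff[OF equiv_gluing])

lemma gluing_cases:
  assumes "(z, w) \<in> gluing g"
  obtains "z = w" | "(z, w) \<in> arc_pairs g" | "(w, z) \<in> arc_pairs g"
  using assms by (auto simp: gluing_def)

lemma arc_pairsE:
  assumes "(z, w) \<in> arc_pairs g"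
  obtains m s where "z = arc_point g m s" "w = arc_point g (m + 2) (1 - s)"
    "m mod 4 < 2" "m + 2 < 4 * g" "0 \<le> s" "s \<le> 1"
proof -
  from assms obtain m s i where *: "z = arc_point g m s" "w = arc_point g (m + 2) (1 - s)"
    "i < g" "m = 4 * i \<or> m = 4 * i + 1" "0 \<le> s" "s \<le> 1"
    unfolding arc_pairs_def by blast
  then have "m mod 4 < 2" "m + 2 < 4 * g"
    by auto
  with * show thesis
    using that by blast
qed

lemma gluing_class_inner: "cmod z < 1 \<Longrightarrow> gluing g `` {z} = {z}"
proof -
  assume z: "cmod z < 1"
  have "w = z" if "(z, w) \<in> gluing g" for w
    using that by (rule gluing_cases) (use z in \<open>auto elim!: arc_pairsE\<close>)
  moreover have "(z, z) \<in> gluing g"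
    unfolding gluing_def by (intro UnI1 Id_onI) (use z in simp)
  ultimately show ?thesis
    by blast
qed

lemma disc_embedding_eq:
  assumes "z \<in> cball 0 1"
  shows "disc_embedding g z = {z / 2}"
proof -
  have "cmod (z / 2) < 1"
    using assms by (simp add: norm_divide)
  then show ?thesis
    by (simp add: disc_embedding_def gluing_class_inner)
qed

lemma inj_on_disc_embedding: "inj_on (disc_embedding g) (cball 0 1)"
  by (rule inj_onI) (simp add: disc_embedding_eq)

lemma continuous_map_disc_embedding: "continuous_map disc (surface g) (disc_embedding g)"
proof -
  have "continuous_map disc disc (\<lambda>z. z / 2)"
    by (auto simp: disc_def norm_divide intro!: continuous_intros)
  from continuous_map_compose[OF this continuous_map_gluing] show ?thesis
    by (simp add: o_def disc_embedding_def[abs_def])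
qed

lemma continuous_map_punctured_disc_embedding:
  assumes "Z \<subseteq> cball 0 1"
  shows "continuous_map (punctured_disc Z) (punctured_surface g Z) (disc_embedding g)"
  unfolding punctured_disc_def punctured_surface_def
proof (rule continuous_map_into_subtopology)
  show "continuous_map (subtopology disc (- Z)) (surface g) (disc_embedding g)"
    by (intro continuous_map_from_subtopology continuous_map_disc_embedding)
  show "disc_embedding g \<in> topspace (subtopology disc (- Z)) \<rightarrow> - disc_embedding g ` Z"
    using assms inj_on_disc_embedding[of g] by (auto simp: inj_on_def)
qed

section \<open>Configuration spaces and their quotients by permutations\<close>

lemma topspace_config:
  "c \<in> topspace (config X m) \<longleftrightarrow> c \<in> (\<Pi>\<^sub>E i\<in>{..<m}. topspace X) \<and> inj_on c {..<m}"
  by (auto simp: config_def)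

lemma quotient_map_orbit: "quotient_map (config X m) (config_quotient X m H) (orbit H)"
  unfolding config_quotient_def by (rule quotient_map_quotient_topology)

lemma continuous_map_orbit: "continuous_map (config X m) (config_quotient X m H) (orbit H)"
  by (rule quotient_imp_continuous_map[OF quotient_map_orbit])

lemma topspace_config_quotient:
  "topspace (config_quotient X m H) = orbit H ` topspace (config X m)"
  by (simp add: config_quotient_def topspace_quotient_topology)

lemma continuous_map_into_config:
  assumes "\<And>i. i < m \<Longrightarrow> continuous_map E X (\<lambda>x. F x i)"
    and "\<And>x. x \<in> topspace E \<Longrightarrow> F x \<in> extensional {..<m} \<and> inj_on (F x) {..<m}"
  shows "continuous_map E (config X m) F"
  using assms unfolding config_def
  by (auto simp: continuous_map_in_subtopology continuous_map_componentwise)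

lemma continuous_map_config_proj: "i < m \<Longrightarrow> continuous_map (config X m) X (\<lambda>c. c i)"
  unfolding config_def
  by (intro continuous_map_from_subtopology continuous_map_product_projection) simp

text \<open>Distinct points must stay distinct. This is automatic when there is at most one point,
  and that alternative is what admits the non-injective retraction of the surface.\<close>

lemma continuous_config_map:
  assumes f: "continuous_map X Y f" and inj: "inj_on f (topspace X) \<or> m \<le> 1"
  shows "continuous_map (config X m) (config Y m) (config_map f m)"
proof (rule continuous_map_into_config)
  fix i assume "i < m"
  then show "continuous_map (config X m) Y (\<lambda>c. config_map f m c i)"
    using continuous_map_compose[OF continuous_map_config_proj f]
    by (simp add: config_map_def o_def)
next
  fix c assume c: "c \<in> topspace (config X m)"
  have "inj_on (config_map f m c) {..<m}"
    using inj
  proof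
    assume "inj_on f (topspace X)"
    then have "inj_on (\<lambda>i. f (c i)) {..<m}"
      using c by (auto simp: topspace_config inj_on_def PiE_def Pi_def)
    then show ?thesis
      by (simp add: config_map_def inj_on_def)
  qed (auto simp: inj_on_def)
  then show "config_map f m c \<in> extensional {..<m} \<and> inj_on (config_map f m c) {..<m}"
    by (simp add: config_map_def)
qed

text \<open>\<open>f\<close> acts on the values and \<open>\<pi>\<close> on the indices, so the two
  actions commute; a permutation of \<open>{..<m}\<close> also respects the restriction to
  \<open>{..<m}\<close> built into \<open>config_map\<close>.\<close>

lemma config_map_orbit:
  assumes "H \<subseteq> {\<pi>. \<pi> permutes {..<m}}"
  shows "config_map f m ` orbit H c = orbit H (config_map f m c)"
proof -
  have "config_map f m (c \<circ> \<pi>) = config_map f m c \<circ> \<pi>" if "\<pi> \<in> H" for \<pi>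
  proof
    fix i
    have "\<pi> permutes {..<m}"
      using that assms by auto
    then show "config_map f m (c \<circ> \<pi>) i = (config_map f m c \<circ> \<pi>) i"
      using permutes_in_image[of \<pi> "{..<m}" i] by (simp add: config_map_def)
  qed
  then show ?thesis
    by (simp add: orbit_def image_image)
qed

lemma continuous_config_quotient_map:
  assumes "continuous_map X Y f" and "inj_on f (topspace X) \<or> m \<le> 1"
    and H: "H \<subseteq> {\<pi>. \<pi> permutes {..<m}}"
  shows "continuous_map (config_quotient X m H) (config_quotient Y m H) ((`) (config_map f m))"
proof -
  have "(`) (config_map f m) \<circ> orbit H = orbit H \<circ> config_map f m"
    by (simp add: fun_eq_iff config_map_orbit[OF H])
  then have "continuous_map (config X m) (config_quotient Y m H) ((`) (config_map f m) \<circ> orbit H)"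
    using continuous_map_compose[OF continuous_config_map[OF assms(1,2)] continuous_map_orbit]
    by simp
  then show ?thesis
    by (rule continuous_compose_quotient_map[OF quotient_map_orbit])
qed

section \<open>A retraction of the surface onto the embedded disc\<close>

text \<open>Outside the half disc, points are pushed towards \<open>\<i>\<close> so strongly that the whole upper unit
  semicircle, which contains all the glued arcs, is sent to \<open>\<i>\<close>. The second factor of the weight
  keeps the negative imaginary axis fixed, so the push never passes through \<open>0\<close>.\<close>

definition push_weight :: "complex \<Rightarrow> real" where
  "push_weight w = (2 * cmod w - 1) * max 0 (min 1 (1 + 2 * Im w))"

definition push :: "complex \<Rightarrow> complex" where
  "push w = of_real (1 - push_weight w) * w + of_real (push_weight w) * \<i>"

text \<open>The half disc is enlarged to the unit disc, which inverts the embedding; the rest is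
  thrown onto the unit circle, away from punctures in the open disc.\<close>

definition collapse :: "complex \<Rightarrow> complex" where
  "collapse w = (if cmod w \<le> 1/2 then 2 * w else push w / of_real (cmod (push w)))"

lemma push_weight_bounds:
  assumes "1/2 \<le> cmod w" "cmod w \<le> 1"
  shows "0 \<le> push_weight w" "push_weight w \<le> 1"
proof -
  show "0 \<le> push_weight w"
    unfolding push_weight_def using assms by (intro mult_nonneg_nonneg) auto
  have "push_weight w \<le> 1 * 1"
    unfolding push_weight_def using assms by (intro mult_mono) auto
  then show "push_weight w \<le> 1"
    by simp
qed

lemma push_nonzero:
  assumes w: "1/2 \<le> cmod w" "cmod w \<le> 1"
  shows "push w \<noteq> 0"
proof
  assume "push w = 0"
  then have "Re (push w) = 0" "Im (push w) = 0"
    by simp_all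
  then have re: "(1 - push_weight w) * Re w = 0" and im: "(1 - push_weight w) * Im w + push_weight w = 0"
    by (simp_all add: push_def)
  have neq: "push_weight w \<noteq> 1"
    using im by auto
  then have "Re w = 0"
    using re by simp
  then have norm: "cmod w = \<bar>Im w\<bar>"
    by (simp add: cmod_def)
  have "1 - push_weight w > 0"
    using push_weight_bounds[OF w] neq by simp
  moreover have "(1 - push_weight w) * Im w \<le> 0"
    using im push_weight_bounds[OF w] by linarith
  ultimately have "Im w \<le> 0"
    by (simp add: mult_le_0_iff)
  \<comment> \<open>On this ray \<open>1 + 2 * Im w = 1 - 2 * cmod w\<close>, which is at most
    \<open>0\<close>, so the second factor of the weight vanishes.\<close>
  then have "push_weight w = 0"
    using norm w by (simp add: push_weight_def)
  then show False
    using im norm w by simp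
qed

lemma norm_collapse:
  assumes "cmod w \<le> 1"
  shows "cmod (collapse w) \<le> 1" "1/2 < cmod w \<Longrightarrow> cmod (collapse w) = 1"
  using assms push_nonzero[of w] by (auto simp: collapse_def norm_mult norm_divide)

lemma continuous_on_collapse: "continuous_on (cball 0 1) collapse"
proof -
  have push: "continuous_on S push" for S
    unfolding push_def push_weight_def by (intro continuous_intros)
  have "continuous_on (cball 0 1 \<inter> {w. cmod w \<le> 1/2} \<union> cball 0 1 \<inter> {w. 1/2 \<le> cmod w})
      (\<lambda>w. if cmod w \<le> 1/2 then 2 * w else push w / of_real (cmod (push w)))"
  proof (rule continuous_on_If)
    show "closed (cball 0 1 \<inter> {w::complex. cmod w \<le> 1/2})" "closed (cball 0 1 \<inter> {w::complex. 1/2 \<le> cmod w})"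
      by (intro closed_Int closed_cball closed_Collect_le continuous_intros)+
    show "continuous_on (cball 0 1 \<inter> {w. cmod w \<le> 1/2}) ((*) (2::complex))"
      by (intro continuous_intros)
    show "continuous_on (cball 0 1 \<inter> {w. 1/2 \<le> cmod w}) (\<lambda>w. push w / of_real (cmod (push w)))"
      using push_nonzero by (intro continuous_intros push) auto
  next
    fix w assume "w \<in> cball 0 1 \<inter> {w. 1/2 \<le> cmod w}" "cmod w \<le> 1/2"
    then have "cmod w = 1/2"
      by auto
    \<comment> \<open>On the common circle nothing is pushed, and dividing by the norm
      \<open>1/2\<close> is the same as doubling.\<close>
    moreover from this have "push_weight w = 0"
      by (simp add: push_weight_def)
    then have "push w = w"
      by (simp add: push_def)
    ultimately have "push w / of_real (cmod (push w)) = w / of_real (1/2)"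
      by (simp only:)
    then show "2 * w = push w / of_real (cmod (push w))"
      by simp
  qed auto
  moreover have "cball 0 1 \<inter> {w. cmod w \<le> 1/2} \<union> cball 0 1 \<inter> {w. 1/2 \<le> cmod w} = cball 0 (1::real)"
    by auto
  ultimately show ?thesis
    by (simp add: collapse_def[abs_def])
qed

text \<open>The denominator \<open>8 * g\<close> is twice the number of arcs, so all the angles lie
  between \<open>0\<close> and \<open>pi\<close>.\<close>

lemma arc_point_Im:
  assumes "m < 4 * g" "0 \<le> s" "s \<le> 1"
  shows "0 \<le> Im (arc_point g m s)"
proof -
  have g: "real g > 0" and "real m + 1 \<le> 4 * real g"
    using assms(1) by linarith+
  then have "2 * real m + s \<le> 8 * real g"
    using assms(3) by linarith
  then have "pi * (2 * real m + s) \<le> pi * (8 * real g)"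
    by (intro mult_left_mono) auto
  then have "pi * (2 * real m + s) / (8 * real g) \<le> pi"
    using g by (simp add: divide_le_eq)
  then show ?thesis
    using assms g by (simp add: arc_point_def sin_ge_zero)
qed

text \<open>On the unit circle the first factor of the weight is \<open>1\<close>, and for
  non-negative imaginary part so is the second. Hence all glued points have the same image and the
  gluing is respected.\<close>

lemma collapse_arc_point:
  assumes "m < 4 * g" "0 \<le> s" "s \<le> 1"
  shows "collapse (arc_point g m s) = \<i>"
  using arc_point_Im[OF assms] by (simp add: collapse_def push_def push_weight_def)

lemma collapse_gluing:
  assumes "(z, w) \<in> gluing g"
  shows "collapse z = collapse w"
  using assms by (rule gluing_cases) (auto elim!: arc_pairsE simp: collapse_arc_point)

text \<open>\<open>collapse\<close> is constant on gluing classes and therefore descends to the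
  surface. Its values outside the embedded disc have norm \<open>1\<close>, so only the punctures of
  the surface can be sent to \<open>Z\<close>.\<close>

lemma surface_retraction:
  assumes Z: "Z \<subseteq> ball 0 1"
  obtains R where "continuous_map (punctured_surface g Z) (punctured_disc Z) R"
    and "\<And>z. z \<in> cball 0 1 \<Longrightarrow> R (disc_embedding g z) = z"
proof -
  have "continuous_map disc disc collapse"
    using continuous_on_collapse norm_collapse(1) by (auto simp: disc_def)
  then obtain R where R: "continuous_map (surface g) disc R"
    "\<And>z. z \<in> topspace disc \<Longrightarrow> R (gluing g `` {z}) = collapse z"
    using quotient_map_lift_exists[OF quotient_map_surface, of disc collapse g]
    by (metis collapse_gluing gluing_class_eq_iff topspace_disc)
  have emb: "R (disc_embedding g z) = z" if "z \<in> cball 0 1" for z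
  proof -
    have "cmod (z / 2) \<le> 1/2"
      using that by (simp add: norm_divide)
    then show ?thesis
      using R(2)[of "z / 2"] that by (simp add: disc_embedding_def collapse_def)
  qed
  have "R x \<notin> Z" if x: "x \<in> topspace (surface g)" "x \<notin> disc_embedding g ` Z" for x
  proof
    assume RZ: "R x \<in> Z"
    obtain z where z: "z \<in> cball 0 1" "x = gluing g `` {z}"
      using x(1) unfolding topspace_surface by blast
    then have Rx: "R x = collapse z"
      using R(2) by simp
    have "cmod (R x) < 1"
      using RZ Z by auto
    then have le: "cmod z \<le> 1/2"
      using norm_collapse(2)[of z] z Rx by force
    then have "x = disc_embedding g (R x)"
      unfolding Rx using z by (simp add: disc_embedding_def collapse_def)
    then show False
      using RZ x(2) by blast
  qed
  then have "continuous_map (punctured_surface g Z) (punctured_disc Z) R"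
    unfolding punctured_disc_def punctured_surface_def
    by (intro continuous_map_into_subtopology continuous_map_from_subtopology R(1)) auto
  then show thesis
    using emb that by blast
qed

lemma one_strand_injective:
  fixes g :: nat
  assumes Z: "Z \<subseteq> ball 0 1" and c: "c \<in> topspace (config (punctured_disc Z) 1)"
  shows "inj_on (ab_map (braid_group (punctured_surface g Z) 1 (config_map (disc_embedding g) 1 c))
      (braid_map (punctured_surface g Z) 1 c (disc_embedding g)))
    (carrier (abelianization (braid_group (punctured_disc Z) 1 c)))"
proof -
  let ?X = "config_quotient (punctured_disc Z) 1 (perms 1)" and ?x = "orbit (perms 1) c"
  let ?Y = "config_quotient (punctured_surface g Z) 1 (perms 1)"
  let ?c' = "config_map (disc_embedding g) 1 c" let ?y = "orbit (perms 1) ?c'"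
  let ?e = "(`) (config_map (disc_embedding g) 1)"
  have perms: "perms 1 \<subseteq> {\<pi>. \<pi> permutes {..<1}}"
    by (simp add: perms_def)
  obtain R where R: "continuous_map (punctured_surface g Z) (punctured_disc Z) R"
    and Re: "\<And>z. z \<in> cball 0 1 \<Longrightarrow> R (disc_embedding g z) = z"
    using surface_retraction[OF Z] by blast
  let ?r = "(`) (config_map R 1)"
  have ZZ: "Z \<subseteq> cball 0 1"
    using Z by auto
  have e: "continuous_map ?X ?Y ?e" and r: "continuous_map ?Y ?X ?r"
    using continuous_config_quotient_map[OF continuous_map_punctured_disc_embedding[OF ZZ] _ perms]
      continuous_config_quotient_map[OF R _ perms] by simp_all
  have id_config: "config_map R 1 (config_map (disc_embedding g) 1 d) = d"
    if "d \<in> topspace (config (punctured_disc Z) 1)" for d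
  proof
    fix i
    have "d 0 \<in> cball 0 1"
      using that by (auto simp: topspace_config topspace_punctured_disc PiE_def Pi_def)
    then show "config_map R 1 (config_map (disc_embedding g) 1 d) i = d i"
      using that Re[of "d 0"]
      by (auto simp: config_map_def topspace_config topspace_punctured_disc PiE_def extensional_def)
  qed
  have re: "?r (?e K) = K" if "K \<in> topspace ?X" for K
  proof -
    obtain d where d: "d \<in> topspace (config (punctured_disc Z) 1)" "K = orbit (perms 1) d"
      using \<open>K \<in> topspace ?X\<close> unfolding topspace_config_quotient by blast
    show ?thesis
      unfolding d(2) config_map_orbit[OF perms] id_config[OF d(1)] ..
  qed
  have xX: "?x \<in> topspace ?X"
    using c by (simp add: topspace_config_quotient)
  have ex: "?e ?x = ?y" and ry: "?r ?y = ?x"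
    using re[OF xX] by (simp_all only: config_map_orbit[OF perms])
  have yY: "?y \<in> topspace ?Y"
    using xX e ex by (metis continuous_map_funspace PiE Pi_iff)
  have inv: "pi1_map ?X ?x ?r (pi1_map ?Y ?y ?e K) = K" if K: "K \<in> carrier (pi1 ?X ?x)" for K
  proof -
    obtain \<gamma> where \<gamma>: "\<gamma> \<in> loops ?X ?x" "K = loop_class ?X ?x \<gamma>"
      using pi1_carrierE[OF K] by blast
    have \<gamma>': "pathin ?X \<gamma>" "\<gamma> 0 = ?x" "\<gamma> 1 = ?x"
      using \<gamma>(1) by (simp_all add: loops_def)
    have "pi1_map ?X ?x ?r (pi1_map ?Y ?y ?e K) = loop_class ?X ?x (?r \<circ> (?e \<circ> \<gamma>))"
      unfolding \<gamma>(2) pi1_map_class[OF \<gamma>(1) e ex]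
      by (rule pi1_map_class[OF compose_loops[OF \<gamma>(1) e ex] r ry])
    also have "\<dots> = loop_class ?X ?x \<gamma>"
    proof (rule loop_class_eqI, rule path_eq_cong)
      show "path_eq ?X ?x ?x \<gamma> \<gamma>"
        by (rule path_eq_refl[OF \<gamma>'])
      \<comment> \<open>\<open>?r\<close> undoes \<open>?e\<close> only on the space itself, and a
        path is known to lie in the space only for parameters in \<open>[0,1]\<close>; the two loops
        are compared there.\<close>
      fix t :: real assume "0 \<le> t" "t \<le> 1"
      then have "\<gamma> t \<in> topspace ?X"
        using path_image_subset_topspace[OF \<gamma>'(1)] by (simp add: Pi_iff)
      then show "(?r \<circ> (?e \<circ> \<gamma>)) t = \<gamma> t"
        by (simp only: o_apply re)
    qed simp
    finally show ?thesis
      using \<gamma>(2) by simp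
  qed
  show ?thesis
    unfolding braid_group_def braid_map_def
    by (rule ab_map_injective[OF group_pi1[OF xX] group_pi1[OF yY] pi1_map_hom[OF e ex]
          pi1_map_hom[OF r ry] inv])
qed

section \<open>Winding numbers\<close>

lemma winding_number_exp:
  assumes l: "path l" and p: "\<And>t. t \<in> {0..1} \<Longrightarrow> p t = exp (l t)"
  shows "winding_number p 0 = (l 1 - l 0) / (2 * of_real pi * \<i>)"
proof -
  have "winding_number p 0 = winding_number (exp \<circ> l) 0"
    by (rule winding_number_cong) (simp add: p)
  then show ?thesis
    using winding_number_compose_exp[OF l] by (simp add: pathfinish_def pathstart_def)
qed

lemma path_logarithm:
  fixes p :: "real \<Rightarrow> complex"
  assumes "path p" "0 \<notin> path_image p"
  obtains l where "path l" "\<And>t. t \<in> {0..1} \<Longrightarrow> p t = exp (l t)"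
proof -
  have "contractible {0..1::real}"
    by (simp add: convex_imp_contractible)
  moreover have "p t \<noteq> 0" if "t \<in> {0..1}" for t
    using assms(2) that unfolding path_image_def by (metis imageI)
  ultimately show thesis
    using continuous_logarithm_on_contractible[of "{0..1}" p] assms(1) that
    unfolding path_def by blast
qed

text \<open>Logarithms of the two paths add, and the winding number is the increment of a logarithm
  divided by \<open>2 * pi * \<i>\<close>.\<close>

lemma winding_number_mult:
  assumes p: "path p" "0 \<notin> path_image p" and q: "path q" "0 \<notin> path_image q"
  shows "winding_number (\<lambda>t. p t * q t) 0 = winding_number p 0 + winding_number q 0"
proof -
  obtain l where l: "path l" "\<And>t. t \<in> {0..1} \<Longrightarrow> p t = exp (l t)"
    using path_logarithm[OF p] by blast
  obtain k where k: "path k" "\<And>t. t \<in> {0..1} \<Longrightarrow> q t = exp (k t)"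
    using path_logarithm[OF q] by blast
  have "path (\<lambda>t. l t + k t)"
    using l(1) k(1) unfolding path_def by (intro continuous_intros)
  then have "winding_number (\<lambda>t. p t * q t) 0 = ((l 1 + k 1) - (l 0 + k 0)) / (2 * of_real pi * \<i>)"
    by (rule winding_number_exp) (simp add: l(2) k(2) exp_add)
  moreover have "winding_number p 0 = (l 1 - l 0) / (2 * of_real pi * \<i>)"
    by (rule winding_number_exp) (fact l)+
  moreover have "winding_number q 0 = (k 1 - k 0) / (2 * of_real pi * \<i>)"
    by (rule winding_number_exp) (fact k)+
  ultimately show ?thesis
    by (simp only: add_divide_distrib diff_divide_distrib) simp
qed

lemma winding_number_prod:
  assumes "finite R" and "\<And>r. r \<in> R \<Longrightarrow> path (f r) \<and> 0 \<notin> path_image (f r)"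
  shows "path (\<lambda>t. \<Prod>r\<in>R. f r t) \<and> 0 \<notin> path_image (\<lambda>t. \<Prod>r\<in>R. f r t) \<and>
    winding_number (\<lambda>t. \<Prod>r\<in>R. f r t) 0 = (\<Sum>r\<in>R. winding_number (f r) 0)"
  using assms
proof (induction R rule: finite_induct)
  case empty
  then show ?case
    by (auto simp: path_def path_image_def winding_number_zero_const)
next
  case (insert r R)
  let ?P = "\<lambda>t. \<Prod>r\<in>R. f r t"
  have IH: "path ?P" "0 \<notin> path_image ?P" "winding_number ?P 0 = (\<Sum>r\<in>R. winding_number (f r) 0)"
    using insert.IH insert.prems by simp_all
  have r: "path (f r)" "0 \<notin> path_image (f r)"
    using insert.prems by simp_all
  have "path (\<lambda>t. f r t * ?P t)"
    using continuous_on_mult[OF r(1)[unfolded path_def] IH(1)[unfolded path_def]] by (simp add: path_def)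
  moreover have "0 \<notin> path_image (\<lambda>t. f r t * ?P t)"
    using r(2) IH(2) unfolding path_image_def by force
  ultimately show ?case
    using winding_number_mult[OF r IH(1,2)] IH(3) insert.hyps by simp
qed

text \<open>The winding number of \<open>f \<circ> \<gamma>\<close> is invariant under homotopy and
  additive under joining, hence a homomorphism to an abelian group; such a homomorphism vanishes on
  the commutator subgroup.\<close>

lemma loop_class_notin_derived:
  fixes f :: "'a \<Rightarrow> complex"
  assumes f: "continuous_map X (top_of_set (- {0})) f" and \<gamma>: "\<gamma> \<in> loops X x"
    and wind: "winding_number (f \<circ> \<gamma>) 0 \<noteq> 0"
  shows "loop_class X x \<gamma> \<notin> Gamma2 (pi1 X x)"
proof -
  \<comment> \<open>The additive group of complex numbers, since \<open>winding_number\<close> takes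
    complex values.\<close>
  define A :: "complex monoid" where "A = \<lparr>carrier = UNIV, mult = (+), one = 0\<rparr>"
  have A: "comm_group A"
    by (rule comm_groupI) (auto simp: A_def add.assoc intro: exI[of _ "- _"] add.left_inverse)
  \<comment> \<open>A representative is chosen arbitrarily; homotopy invariance makes the choice
    immaterial.\<close>
  define w where "w K = winding_number (f \<circ> (SOME \<delta>. \<delta> \<in> K)) 0" for K
  have w: "w (loop_class X x \<delta>) = winding_number (f \<circ> \<delta>) 0" if "\<delta> \<in> loops X x" for \<delta>
  proof -
    have "\<delta> \<in> loop_class X x \<delta>"
      using that by (simp add: loop_class_path_eq loops_path_eq)
    then have "(SOME \<epsilon>. \<epsilon> \<in> loop_class X x \<delta>) \<in> loop_class X x \<delta>"
      by (rule someI[where P = "\<lambda>\<epsilon>. \<epsilon> \<in> loop_class X x \<delta>"])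
    then have "path_eq X x x \<delta> (SOME \<epsilon>. \<epsilon> \<in> loop_class X x \<delta>)"
      by (simp add: loop_class_path_eq)
    from path_eq_compose[OF this f]
    have "homotopic_paths (- {0}) (f \<circ> \<delta>) (f \<circ> (SOME \<epsilon>. \<epsilon> \<in> loop_class X x \<delta>))"
      using that unfolding path_eq_def homotopic_paths_def
      by (simp add: pathstart_def pathfinish_def loops_def)
    then show ?thesis
      unfolding w_def by (rule winding_number_homotopic_paths[symmetric])
  qed
  have path: "path (f \<circ> \<delta>)" "0 \<notin> path_image (f \<circ> \<delta>)" if "\<delta> \<in> loops X x" for \<delta>
    using pathin_compose[OF _ f, of \<delta>] that by (auto simp: loops_def pathin_canon_iff path_image_def)
  have "w \<in> hom (pi1 X x) A"
  proof (rule homI)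
    fix K L assume "K \<in> carrier (pi1 X x)" "L \<in> carrier (pi1 X x)"
    then obtain \<delta> \<epsilon> where *: "\<delta> \<in> loops X x" "K = loop_class X x \<delta>"
      "\<epsilon> \<in> loops X x" "L = loop_class X x \<epsilon>"
      by (metis pi1_carrierE)
    have "pathfinish (f \<circ> \<delta>) = pathstart (f \<circ> \<epsilon>)"
      using *(1,3) by (simp add: loops_def pathfinish_def pathstart_def)
    then show "w (K \<otimes>\<^bsub>pi1 X x\<^esub> L) = w K \<otimes>\<^bsub>A\<^esub> w L"
      using winding_number_join[OF path[OF *(1)] path[OF *(3)]] *
      by (simp add: pi1_mult w join_loops join_compose join_eq_joinpaths A_def)
  qed (simp add: A_def)
  moreover have "x \<in> topspace X"
    using \<gamma> path_start_in_topspace[of X \<gamma>] by (simp add: loops_def)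
  ultimately have "w (loop_class X x \<gamma>) = 0" if "loop_class X x \<gamma> \<in> Gamma2 (pi1 X x)"
    using hom_comm_group_derived[OF group_pi1 A _ that, of w] by (simp add: A_def)
  then show ?thesis
    using wind w[OF \<gamma>] by auto
qed

section \<open>Two crossing loops on the surface\<close>

text \<open>The midpoint of arc \<open>k\<close>. The parameter \<open>1/2\<close> is fixed by the
  reversal of direction in the gluing, so midpoints are glued to midpoints.\<close>

definition corner :: "nat \<Rightarrow> nat \<Rightarrow> complex" where
  "corner g k = arc_point g k (1/2)"

lemma norm_corner [simp]: "cmod (corner g k) = 1"
  by (simp add: corner_def)

lemma corner_gluing_cases:
  assumes "(corner g k, w) \<in> gluing g" and k: "k < 4 * g"
  shows "w = corner g k \<or> (k mod 4 < 2 \<and> w = corner g (k + 2)) \<or>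
    (\<exists>m. k = m + 2 \<and> m mod 4 < 2 \<and> w = corner g m)"
  using assms(1)
proof (rule gluing_cases)
  assume "(corner g k, w) \<in> arc_pairs g"
  then obtain m s where *: "corner g k = arc_point g m s" "w = arc_point g (m + 2) (1 - s)"
    "m mod 4 < 2" "m + 2 < 4 * g" "0 \<le> s" "s \<le> 1"
    by (rule arc_pairsE)
  then have "k = m" "s = 1/2"
    using arc_point_inj[of k g m "1/2" s] k by (simp_all add: corner_def)
  then show ?thesis
    using *(2,3) unfolding \<open>k = m\<close> \<open>s = 1/2\<close> corner_def by simp
next
  assume "(w, corner g k) \<in> arc_pairs g"
  then obtain m s where *: "w = arc_point g m s" "corner g k = arc_point g (m + 2) (1 - s)"
    "m mod 4 < 2" "m + 2 < 4 * g" "0 \<le> s" "s \<le> 1"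
    by (rule arc_pairsE)
  then have "k = m + 2" "1/2 = 1 - s"
    using arc_point_inj[of k g "m + 2" "1/2" "1 - s"] k by (simp_all add: corner_def)
  moreover from this have "s = 1/2"
    by simp
  then have "w = corner g m"
    using *(1) by (simp only: corner_def)
  ultimately show ?thesis
    using *(3) by blast
qed auto

text \<open>The chords joining corner \<open>0\<close> to \<open>2\<close> and corner
  \<open>1\<close> to \<open>3\<close> thus close up on the surface. That the classes contain
  nothing else is what later keeps the two strands apart.\<close>

lemma corner_class:
  assumes "g \<ge> 1"
  shows "gluing g `` {corner g 0} = {corner g 0, corner g 2}"
    "gluing g `` {corner g 1} = {corner g 1, corner g 3}"
    "gluing g `` {corner g 2} = {corner g 0, corner g 2}"
    "gluing g `` {corner g 3} = {corner g 1, corner g 3}"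
proof -
  have pair: "(corner g m, corner g l) \<in> gluing g" if "m = 0 \<or> m = 1" "l = m + 2" for m l
  proof -
    have "(arc_point g m (1/2), arc_point g (m + 2) (1 - 1/2)) \<in> arc_pairs g"
      unfolding arc_pairs_def using that(1) assms
      by (intro CollectI exI[of _ m] exI[of _ "1/2::real"] conjI refl exI[of _ 0]) auto
    then show ?thesis
      by (simp add: gluing_def corner_def that(2))
  qed
  have 0: "gluing g `` {corner g 0} = gluing g `` {corner g 2}"
    and 1: "gluing g `` {corner g 1} = gluing g `` {corner g 3}"
    using pair[of 0 2] pair[of 1 3] by (simp_all add: gluing_class_eq_iff)
  have self: "corner g k \<in> gluing g `` {corner g k}" for k
    by (simp add: gluing_def Id_on_def)
  have "w \<in> {corner g 0, corner g 2}" if "(corner g 0, w) \<in> gluing g" for w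
    using corner_gluing_cases[OF that] assms by (auto simp: numeral_2_eq_2)
  then have sub0: "gluing g `` {corner g 0} \<subseteq> {corner g 0, corner g 2}"
    by blast
  have "w \<in> {corner g 1, corner g 3}" if "(corner g 1, w) \<in> gluing g" for w
    using corner_gluing_cases[OF that] assms by (auto simp: numeral_3_eq_3)
  then have sub1: "gluing g `` {corner g 1} \<subseteq> {corner g 1, corner g 3}"
    by blast
  show "gluing g `` {corner g 0} = {corner g 0, corner g 2}"
    "gluing g `` {corner g 1} = {corner g 1, corner g 3}"
    using sub0 sub1 self[of 0] self[of 1] self[of 2] self[of 3] 0 1 by blast+
  then show "gluing g `` {corner g 2} = {corner g 0, corner g 2}"
    "gluing g `` {corner g 3} = {corner g 1, corner g 3}"
    using 0 1 by simp_all
qed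

section \<open>Angles, heights and the crossing of the two chords\<close>

definition step :: "nat \<Rightarrow> real" where
  "step g = pi / (8 * real g)"

text \<open>Neighbouring corners are \<open>2 * step g\<close> apart, and
  \<open>7/2 * step g\<close> is the mean angle of the corners \<open>0\<close> to \<open>3\<close>.
  After this rotation they sit at \<open>-3\<close>, \<open>-1\<close>, \<open>1\<close> and
  \<open>3\<close> steps, symmetric about the real axis.\<close>

lemma corner_cis: "corner g k = cis (7/2 * step g) * cis ((2 * real k - 3) * step g)"
proof -
  have "pi * (2 * real k + 1/2) / (8 * real g) = 7/2 * step g + (2 * real k - 3) * step g"
    by (cases "g = 0") (simp_all add: step_def field_simps)
  then show ?thesis
    by (simp add: corner_def arc_point_def cis_mult)
qed

lemma step_bounds:
  assumes "g \<ge> 1"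
  shows "0 < step g" "step g \<le> pi / 8"
  using assms by (simp_all add: step_def field_simps)

text \<open>\<open>cos (2 * step g)\<close> is the distance of a chord from \<open>0\<close>. It
  exceeds the radius \<open>1/2\<close> of the embedded disc because \<open>2 * step g\<close> is at
  most \<open>pi / 4\<close>, below \<open>pi / 3\<close>. The other two facts separate it from the
  heights \<open>1\<close> and \<open>cos (4 * step g)\<close> of corners off the chord.\<close>

lemma step_cos:
  assumes "g \<ge> 1"
  shows "1/2 < cos (2 * step g)" "cos (2 * step g) < 1" "cos (4 * step g) \<noteq> cos (2 * step g)"
proof -
  note b = step_bounds[OF assms]
  have "cos (pi / 3) < cos (2 * step g)"
    using b pi_gt_zero by (intro cos_monotone_0_pi) linarith+
  then show "1/2 < cos (2 * step g)"
    by (simp add: cos_60)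
  have "cos (2 * step g) < cos 0"
    using b pi_gt_zero by (intro cos_monotone_0_pi) linarith+
  then show "cos (2 * step g) < 1"
    by simp
  have "cos (4 * step g) < cos (2 * step g)"
    using b pi_gt_zero by (intro cos_monotone_0_pi) linarith+
  then show "cos (4 * step g) \<noteq> cos (2 * step g)"
    by simp
qed

text \<open>The signed height of \<open>w\<close> in the direction of \<open>corner g k\<close>, which is orthogonal to the chord
  from \<open>corner g (k - 1)\<close> to \<open>corner g (k + 1)\<close>.\<close>

definition height :: "nat \<Rightarrow> nat \<Rightarrow> complex \<Rightarrow> real" where
  "height g k w = Re (w * cnj (corner g k))"

lemma height_corner: "height g k (corner g l) = cos ((2 * real l - 2 * real k) * step g)"
proof -
  have "corner g l * cnj (corner g k) = cis ((2 * real l - 2 * real k) * step g)"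
    by (simp add: corner_cis cis_cnj cis_mult) (simp add: algebra_simps)
  then show ?thesis
    by (simp add: height_def)
qed

lemma height_le_norm: "height g k w \<le> cmod w"
  using complex_Re_le_cmod[of "w * cnj (corner g k)"] by (simp add: height_def norm_mult)

text \<open>The height is real linear in \<open>w\<close>, and both end points are at angle
  \<open>2 * step g\<close> from the corner between them.\<close>

lemma height_chord:
  assumes "w \<in> closed_segment (corner g k) (corner g l)" "l = k + 2" "h = k + 1"
  shows "height g h w = cos (2 * step g)"
proof -
  obtain t where t: "w = (1 - t) *\<^sub>R corner g k + t *\<^sub>R corner g l"
    using assms(1) by (auto simp: in_segment)
  have "height g h w = (1 - t) * height g h (corner g k) + t * height g h (corner g l)"
    by (simp add: t height_def algebra_simps)
  also have "\<dots> = (1 - t) * cos (2 * step g) + t * cos (2 * step g)"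
    by (simp add: height_corner assms(2,3))
  finally show ?thesis
    by (simp add: algebra_simps)
qed

abbreviation chord :: "nat \<Rightarrow> nat \<Rightarrow> nat \<Rightarrow> complex set" where
  "chord g k l \<equiv> closed_segment (corner g k) (corner g l)"

lemma norm_chord:
  assumes "g \<ge> 1" "w \<in> chord g k (k + 2)"
  shows "1/2 < cmod w" "cmod w \<le> 1"
proof -
  show "1/2 < cmod w"
    using height_chord[OF assms(2) refl refl] height_le_norm[of g "k + 1" w] step_cos(1)[OF assms(1)] by linarith
  have "chord g k (k + 2) \<subseteq> cball 0 1"
    by (rule closed_segment_subset) auto
  then show "cmod w \<le> 1"
    using assms(2) by auto
qed

text \<open>The height in the direction of the middle corner is constant on a chord, but takes a
  different value at each of the two corners in question.\<close>

lemma corner_notin_chord: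
  assumes "g \<ge> 1"
  shows "corner g 0 \<notin> chord g 1 3" "corner g 2 \<notin> chord g 1 3" "corner g 1 \<notin> chord g 0 2" "corner g 3 \<notin> chord g 0 2"
proof -
  have *: "height g 2 w = cos (2 * step g)" if "w \<in> chord g 1 3" for w
    by (rule height_chord[OF that]) simp_all
  have **: "height g 1 w = cos (2 * step g)" if "w \<in> chord g 0 2" for w
    by (rule height_chord[OF that]) simp_all
  show "corner g 0 \<notin> chord g 1 3" "corner g 2 \<notin> chord g 1 3"
    using *[of "corner g 0"] *[of "corner g 2"] step_cos[OF assms] by (auto simp: height_corner)
  show "corner g 1 \<notin> chord g 0 2" "corner g 3 \<notin> chord g 0 2"
    using **[of "corner g 1"] **[of "corner g 3"] step_cos[OF assms] by (auto simp: height_corner)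
qed

lemma step_trig:
  assumes "g \<ge> 1"
  shows "0 < sin (step g)" "0 < sin (3 * step g)" "0 < cos (3 * step g)" "cos (3 * step g) < cos (step g)"
    "cos (step g) < 1"
proof -
  note b = step_bounds[OF assms]
  show "0 < sin (step g)" "0 < sin (3 * step g)" "0 < cos (3 * step g)"
    using b pi_gt_zero by (intro sin_gt_zero cos_gt_zero_pi; linarith)+
  show "cos (3 * step g) < cos (step g)"
    using b pi_gt_zero by (intro cos_monotone_0_pi) linarith+
  have "cos (step g) < cos 0"
    using b pi_gt_zero by (intro cos_monotone_0_pi) linarith+
  then show "cos (step g) < 1"
    by simp
qed

lemma corners_explicit:
  shows "corner g 0 = cis (7/2 * step g) * Complex (cos (3 * step g)) (- sin (3 * step g))"
    "corner g 1 = cis (7/2 * step g) * Complex (cos (step g)) (- sin (step g))"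
    "corner g 2 = cis (7/2 * step g) * Complex (cos (step g)) (sin (step g))"
    "corner g 3 = cis (7/2 * step g) * Complex (cos (3 * step g)) (sin (3 * step g))"
  by (simp_all add: corner_cis) (simp_all add: complex_eq_iff)

text \<open>In the rotated coordinates the two chords are mirror images of each other in the real
  axis, so they meet on that axis.\<close>

lemma chords_cross:
  assumes "g \<ge> 1"
  obtains X where "X \<in> chord g 0 2" "X \<in> chord g 1 3" "cmod X < 1"
proof -
  define c1 s1 c3 s3 where "c1 = cos (step g)" and "s1 = sin (step g)"
    and "c3 = cos (3 * step g)" and "s3 = sin (3 * step g)"
  note b = step_trig[OF assms, folded c1_def s1_def c3_def s3_def]
  note corners = corners_explicit[of g, folded c1_def s1_def c3_def s3_def]
  \<comment> \<open>The parameter at which the chord from corner \<open>0\<close> to corner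
    \<open>2\<close> crosses the real axis; by the symmetry the other chord crosses it at
    \<open>1 - t\<close>.\<close>
  define t where "t = s3 / (s1 + s3)"
  have t: "0 \<le> t" "t \<le> 1" "1 - t = s1 / (s1 + s3)"
    using b by (simp_all add: t_def field_simps)
  have y: "(1 - t) * s3 = t * s1"
    unfolding t(3) by (simp add: t_def)
  define X where "X = cis (7/2 * step g) * of_real ((1 - t) * c3 + t * c1)"
  have "X = (1 - t) *\<^sub>R corner g 0 + t *\<^sub>R corner g 2"
  proof -
    have "complex_of_real ((1 - t) * c3 + t * c1) = (1 - t) *\<^sub>R Complex c3 (- s3) + t *\<^sub>R Complex c1 s1"
      using y by (simp add: complex_eq_iff)
    then show ?thesis
      unfolding X_def corners by (simp only: scaleR_conv_of_real) (simp add: algebra_simps)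
  qed
  then have 1: "X \<in> chord g 0 2"
    using t by (auto simp: in_segment)
  have "X = (1 - (1 - t)) *\<^sub>R corner g 1 + (1 - t) *\<^sub>R corner g 3"
  proof -
    have "complex_of_real ((1 - t) * c3 + t * c1) = (1 - (1 - t)) *\<^sub>R Complex c1 (- s1) + (1 - t) *\<^sub>R Complex c3 s3"
      using y by (simp add: complex_eq_iff)
    then show ?thesis
      unfolding X_def corners by (simp only: scaleR_conv_of_real) (simp add: algebra_simps)
  qed
  then have 2: "X \<in> chord g 1 3"
    using t by (auto simp: in_segment intro!: exI[of _ "1 - t"])
  have "(1 - t) * c3 + t * c1 \<le> (1 - t) * c1 + t * c1"
    using b t by (intro add_mono mult_left_mono) auto
  also have "\<dots> = c1"
    by (simp add: algebra_simps)
  finally have "(1 - t) * c3 + t * c1 < 1"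
    using b by linarith
  moreover have "0 \<le> (1 - t) * c3 + t * c1"
    using b t by (intro add_nonneg_nonneg mult_nonneg_nonneg) linarith+
  moreover have "cmod X = \<bar>(1 - t) * c3 + t * c1\<bar>"
    unfolding X_def norm_mult norm_of_real by simp
  ultimately have "cmod X < 1"
    by simp
  with 1 2 show thesis
    using that by blast
qed

text \<open>The boundary of the square \<open>(s, t) \<mapsto> (b s, a t)\<close>, where \<open>a\<close> and \<open>b\<close> run along the chords
  \<open>chord g 0 2\<close> and \<open>chord g 1 3\<close>, which become closed loops on the surface.\<close>

definition square_path :: "nat \<Rightarrow> real \<Rightarrow> complex \<times> complex" where
  "square_path g = join (join (join
      (\<lambda>s. (linepath (corner g 1) (corner g 3) s, corner g 0))
      (\<lambda>t. (corner g 3, linepath (corner g 0) (corner g 2) t)))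
      (\<lambda>s. (linepath (corner g 3) (corner g 1) s, corner g 2)))
      (\<lambda>t. (corner g 1, linepath (corner g 2) (corner g 0) t))"

lemma square_path_ends [simp]:
  "square_path g 0 = (corner g 1, corner g 0)" "square_path g 1 = (corner g 1, corner g 0)"
  by (simp_all add: square_path_def linepath_def)

lemma path_square_path: "path (square_path g)"
  unfolding square_path_def join_eq_joinpaths
  by (intro path_join_imp)
    (auto simp: path_def pathstart_def pathfinish_def joinpaths_def linepath_def intro!: continuous_intros)

lemma square_path_chords:
  assumes "\<tau> \<in> {0..1}" "square_path g \<tau> = (u, v)"
  shows "u \<in> chord g 1 3 \<and> v \<in> chord g 0 2 \<and>
    (u = corner g 1 \<or> u = corner g 3 \<or> v = corner g 0 \<or> v = corner g 2)"
proof -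
  have lp: "linepath a b t \<in> closed_segment a b" if "0 \<le> t" "t \<le> 1" for a b :: complex and t
    using that by (auto simp: in_segment linepath_def)
  have lp': "linepath a b t \<in> closed_segment b a" if "0 \<le> t" "t \<le> 1" for a b :: complex and t
    using lp[OF that] by (simp add: closed_segment_commute)
  show ?thesis
    using assms by (auto simp: square_path_def join_def intro!: lp lp' split: if_splits)
qed

text \<open>On each side of the square one strand rests at an end of its own chord. Its class
  consists of the two ends of that chord, and neither lies on the other chord, so the strands do not
  collide on the surface.\<close>

lemma square_path_inequivalent:
  assumes g: "g \<ge> 1" and "\<tau> \<in> {0..1}" "square_path g \<tau> = (u, v)"
  shows "gluing g `` {u} \<noteq> gluing g `` {v}"
proof -
  note * = square_path_chords[OF assms(2,3)]
  note no = corner_notin_chord[OF g]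
  have "cmod u \<le> 1" "cmod v \<le> 1"
    using * norm_chord(2)[OF g, of u 1] norm_chord(2)[OF g, of v 0] by (simp_all add: numeral_3_eq_3 numeral_2_eq_2)
  then have self: "u \<in> gluing g `` {u}" "v \<in> gluing g `` {v}"
    by (auto simp: gluing_def intro!: Id_onI)
  show ?thesis
    using * self no corner_class[OF g] by (metis insertE singletonD)
qed

text \<open>The difference runs along four straight segments, each seen from \<open>0\<close> under
  a positive angle, so each contributes positively. The factor \<open>\<mu>\<close> may be negative,
  which covers the difference taken in the opposite order.\<close>

lemma square_path_winding:
  fixes \<mu> :: real
  assumes g: "g \<ge> 1" and \<mu>: "\<mu> \<noteq> 0"
  defines "p \<equiv> \<lambda>\<tau>. \<mu> *\<^sub>R (fst (square_path g \<tau>) - snd (square_path g \<tau>))"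
  shows "0 < Re (winding_number p 0)"
proof -
  define V where "V k l = \<mu> *\<^sub>R (corner g k - corner g l)" for k l
  have p: "p = ((linepath (V 1 0) (V 3 0) +++ linepath (V 3 0) (V 3 2)) +++ linepath (V 3 2) (V 1 2))
      +++ linepath (V 1 2) (V 1 0)"
    by (rule ext) (simp add: p_def V_def square_path_def join_eq_joinpaths joinpaths_def linepath_def
        algebra_simps scaleR_diff_right scaleR_add_right)
  define c1 s1 c3 s3 where "c1 = cos (step g)" and "s1 = sin (step g)"
    and "c3 = cos (3 * step g)" and "s3 = sin (3 * step g)"
  note b = step_trig[OF g, folded c1_def s1_def c3_def s3_def]
  note corners = corners_explicit[of g, folded c1_def s1_def c3_def s3_def]
  define e where "e = cis (7/2 * step g)"
  have e: "e * cnj e = 1"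
    by (simp add: e_def cis_cnj cis_mult)
  have V: "V 1 0 = e * (\<mu> *\<^sub>R Complex (c1 - c3) (s3 - s1))" "V 3 0 = e * (\<mu> *\<^sub>R Complex 0 (2 * s3))"
    "V 3 2 = e * (\<mu> *\<^sub>R Complex (c3 - c1) (s3 - s1))" "V 1 2 = e * (\<mu> *\<^sub>R Complex 0 (- 2 * s1))"
    unfolding V_def corners e_def[symmetric] by (simp_all only: scaleR_conv_of_real)
      (simp_all add: complex_eq_iff algebra_simps)
  \<comment> \<open>The common rotation \<open>e\<close> has modulus \<open>1\<close> and drops out
    of the orientation test.\<close>
  have rot: "Im ((e * y - e * x) * cnj (e * y - 0)) = Im ((y - x) * cnj y)" for x y
  proof -
    have "(e * y - e * x) * cnj (e * y - 0) = (e * cnj e) * ((y - x) * cnj y)"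
      by (simp add: algebra_simps)
    then show ?thesis
      by (simp only: e) simp
  qed
  have pos: "0 < \<mu> * \<mu>"
    using \<mu> by (simp add: zero_less_mult_iff) linarith
  have side: "0 < Im ((\<mu> *\<^sub>R y - \<mu> *\<^sub>R x) * cnj (\<mu> *\<^sub>R y))" if "0 < Re x * Im y - Im x * Re y" for x y
  proof -
    have eq: "Im ((\<mu> *\<^sub>R y - \<mu> *\<^sub>R x) * cnj (\<mu> *\<^sub>R y)) = (\<mu> * \<mu>) * (Re x * Im y - Im x * Re y)"
      by (simp add: algebra_simps)
    show ?thesis
      unfolding eq by (rule mult_pos_pos[OF pos that])
  qed
  have d: "0 < (c1 - c3) * s3" "0 < (c1 - c3) * s1"
    using b by simp_all
  have cross: "0 < Im ((V 3 0 - V 1 0) * cnj (V 3 0 - 0))" "0 < Im ((V 3 2 - V 3 0) * cnj (V 3 2 - 0))"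
    "0 < Im ((V 1 2 - V 3 2) * cnj (V 1 2 - 0))" "0 < Im ((V 1 0 - V 1 2) * cnj (V 1 0 - 0))"
    unfolding V rot by (rule side, use d in \<open>simp add: algebra_simps\<close>)+
  note l = cross[THEN winding_number_linepath_pos_lt]
  \<comment> \<open>If \<open>0\<close> were on the segment, a real multiple of
    \<open>(b - a) * cnj b\<close> would be the real number \<open>b * cnj b\<close>. Positivity of
    the imaginary part then forces \<open>t = 1\<close>, hence \<open>b = 0\<close>, which is
    absurd.\<close>
  have seg: "0 \<notin> closed_segment a b" if "0 < Im ((b - a) * cnj b)" for a b :: complex
  proof
    assume "0 \<in> closed_segment a b"
    then obtain t where t: "(1 - t) *\<^sub>R a + t *\<^sub>R b = 0"
      by (auto simp: in_segment)
    have "(1 - t) *\<^sub>R (b - a) = b - ((1 - t) *\<^sub>R a + t *\<^sub>R b)"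
      by (simp add: algebra_simps)
    then have "(1 - t) *\<^sub>R ((b - a) * cnj b) = b * cnj b"
      unfolding t by (metis diff_zero mult_scaleR_left)
    then have "Im ((1 - t) *\<^sub>R ((b - a) * cnj b)) = 0"
      by (simp add: mult.commute)
    then have "t = 1"
      using that by simp
    then show False
      using t that by simp
  qed
  note nz = cross[unfolded diff_zero, THEN seg, folded path_image_linepath]
  show ?thesis
    unfolding p using l nz by (simp add: winding_number_join path_image_join)
qed

section \<open>Two strands exchanged around a handle\<close>

lemma inj_on_two_updates:
  assumes "inj_on f A" "a \<notin> f ` (A - {p, q})" "b \<notin> f ` (A - {p, q})" "a \<noteq> b"
  shows "inj_on (f(p := a, q := b)) A"
proof (rule inj_onI)
  fix x y assume "x \<in> A" "y \<in> A" and eq: "(f(p := a, q := b)) x = (f(p := a, q := b)) y"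
  then show "x = y"
    using assms(2-4) inj_onD[OF assms(1), of x y]
    by (auto split: if_splits)
qed

text \<open>A full twist of the strands \<open>p\<close> and \<open>q\<close> is trivialized by the handle; it is detected in the
  disc by the winding of the product of \<open>c i - c j\<close> over an \<open>H\<close>-invariant set \<open>R\<close> of index pairs.\<close>

locale two_strands =
  fixes g m :: nat and Z :: "complex set" and H :: "(nat \<Rightarrow> nat) set"
    and R :: "(nat \<times> nat) set" and c :: "nat \<Rightarrow> complex" and p q :: nat
  assumes genus: "g \<ge> 1"
    and finite_Z: "finite Z" and Z: "Z \<subseteq> ball 0 1"
    and c: "c \<in> topspace (config (punctured_disc Z) m)"
    and H: "H \<subseteq> {\<pi>. \<pi> permutes {..<m}}" and id_H: "id \<in> H"
    and R: "R \<subseteq> {..<m} \<times> {..<m}" and R_irrefl: "(i, i) \<notin> R"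
    and R_H: "\<pi> \<in> H \<Longrightarrow> (i, j) \<in> R \<Longrightarrow> (\<pi> i, \<pi> j) \<in> R"
    and pq: "(p, q) \<in> R"
begin

abbreviation "disc_space \<equiv> config_quotient (punctured_disc Z) m H"
abbreviation "surf_space \<equiv> config_quotient (punctured_surface g Z) m H"
abbreviation "c' \<equiv> config_map (disc_embedding g) m c"
abbreviation "inclusion \<equiv> (`) (config_map (disc_embedding g) m)"

text \<open>The obstacles for the two moving strands, namely the punctures and the resting strands,
  in the coordinates of the glued disc, where the embedded disc has radius
  \<open>1/2\<close>.\<close>

definition W :: "complex set" where
  "W = (\<lambda>z. z / 2) ` (Z \<union> c ` ({..<m} - {p, q}))"

definition disc_pairs :: "(complex \<times> complex) set" where
  "disc_pairs = {(u, v). u \<in> cball 0 (1/2) - W \<and> v \<in> cball 0 (1/2) - W \<and> u \<noteq> v}"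

definition surf_pairs :: "(complex \<times> complex) set" where
  "surf_pairs = {(u, v). u \<in> cball 0 1 - W \<and> v \<in> cball 0 1 - W \<and> gluing g `` {u} \<noteq> gluing g `` {v}}"

text \<open>Positions are given in the coordinates of the glued disc, and doubling returns them to
  the original disc. One and the same path of pairs can thus drive the strands in the disc and on
  the surface.\<close>

definition disc_config :: "complex \<times> complex \<Rightarrow> nat \<Rightarrow> complex" where
  "disc_config w = c(p := 2 * fst w, q := 2 * snd w)"

definition surf_config :: "complex \<times> complex \<Rightarrow> nat \<Rightarrow> complex set" where
  "surf_config w = c'(p := gluing g `` {fst w}, q := gluing g `` {snd w})"

abbreviation "disc_move \<equiv> orbit H \<circ> disc_config"
abbreviation "surf_move \<equiv> orbit H \<circ> surf_config"

lemma pq': "p < m" "q < m" "p \<noteq> q"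
  using R pq R_irrefl[of p] by auto

lemma finite_W: "finite W"
  by (simp add: W_def finite_Z)

lemma c_props: "i < m \<Longrightarrow> c i \<in> cball 0 1 - Z" "inj_on c {..<m}" "c \<in> extensional {..<m}"
  using c by (auto simp: topspace_config topspace_punctured_disc PiE_def Pi_def)

lemma Z_cball: "Z \<subseteq> cball 0 1"
  using Z by auto

lemma W_cball: "W \<subseteq> cball 0 (1/2)"
  using Z_cball c_props(1) by (auto simp: W_def norm_divide dist_norm)

lemma halves_notin_W: "c p / 2 \<notin> W" "c q / 2 \<notin> W" "c p / 2 \<noteq> c q / 2"
proof -
  have "c i / 2 \<notin> W" if i: "i = p \<or> i = q" for i
  proof
    assume "c i / 2 \<in> W"
    then obtain z where "c i / 2 = z / 2" "z \<in> Z \<union> c ` ({..<m} - {p, q})"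
      unfolding W_def by (rule imageE)
    then have "c i \<in> Z \<union> c ` ({..<m} - {p, q})"
      by simp
    then show False
      using i pq' c_props(1)[of i] inj_onD[OF c_props(2), of i] by auto
  qed
  then show "c p / 2 \<notin> W" "c q / 2 \<notin> W"
    by simp_all
  show "c p / 2 \<noteq> c q / 2"
    using pq' inj_onD[OF c_props(2), of p q] by auto
qed

lemma continuous_inclusion: "continuous_map disc_space surf_space inclusion"
  using inj_on_subset[OF inj_on_disc_embedding[of g], of "topspace (punctured_disc Z)"]
  by (intro continuous_config_quotient_map continuous_map_punctured_disc_embedding Z_cball H)
    (auto simp: topspace_punctured_disc)

lemma inclusion_base: "inclusion (orbit H c) = orbit H c'"
  by (rule config_map_orbit[OF H])

lemma surf_c: "c' \<in> topspace (config (punctured_surface g Z) m)"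
proof -
  have "continuous_map (config (punctured_disc Z) m) (config (punctured_surface g Z) m) (config_map (disc_embedding g) m)"
    using inj_on_subset[OF inj_on_disc_embedding[of g], of "topspace (punctured_disc Z)"]
    by (intro continuous_config_map continuous_map_punctured_disc_embedding Z_cball)
      (auto simp: topspace_punctured_disc)
  then show ?thesis
    using c by (simp add: continuous_map_def Pi_iff)
qed

lemma gluing_class_embedding:
  assumes "u \<in> cball 0 1" "gluing g `` {u} = disc_embedding g z" "z \<in> cball 0 1"
  shows "u = z / 2"
proof -
  have "u \<in> gluing g `` {u}"
    using assms(1) by (auto simp: gluing_def intro!: Id_onI)
  then show ?thesis
    using assms by (simp add: disc_embedding_eq)
qed

lemma gluing_class_avoids:
  assumes u: "u \<in> cball 0 1 - W"
  shows "gluing g `` {u} \<in> topspace (punctured_surface g Z)"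
    and "gluing g `` {u} \<notin> c' ` ({..<m} - {p, q})"
proof -
  have "gluing g `` {u} \<noteq> disc_embedding g z" if "z \<in> Z \<union> c ` ({..<m} - {p, q})" for z
  proof
    assume eq: "gluing g `` {u} = disc_embedding g z"
    have "z \<in> cball 0 1"
      using that Z_cball c_props(1) by auto
    then have "u = z / 2"
      using gluing_class_embedding[OF _ eq] u by blast
    then show False
      using that u by (auto simp: W_def)
  qed
  note * = this
  show "gluing g `` {u} \<in> topspace (punctured_surface g Z)"
    using * u by (auto simp: punctured_surface_def topspace_surface)
  show "gluing g `` {u} \<notin> c' ` ({..<m} - {p, q})"
    using * by (auto simp: config_map_def)
qed

lemma continuous_surf_config:
  "continuous_map (top_of_set surf_pairs) (config (punctured_surface g Z) m) surf_config"
proof (rule continuous_map_into_config)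
  have coord: "continuous_map (top_of_set surf_pairs) (punctured_surface g Z) (\<lambda>w. gluing g `` {f w})"
    if f: "continuous_on surf_pairs f" "\<And>w. w \<in> surf_pairs \<Longrightarrow> f w \<in> cball 0 1 - W" for f
  proof -
    have "continuous_map (top_of_set surf_pairs) disc f"
      using f by (auto simp: disc_def)
    from continuous_map_compose[OF this continuous_map_gluing]
    have "continuous_map (top_of_set surf_pairs) (surface g) (\<lambda>w. gluing g `` {f w})"
      by (simp add: o_def)
    moreover have "gluing g `` {f w} \<in> - (disc_embedding g ` Z)" if "w \<in> surf_pairs" for w
      using gluing_class_avoids(1)[OF f(2)[OF that]] by (simp add: punctured_surface_def)
    ultimately show ?thesis
      unfolding punctured_surface_def by (intro continuous_map_into_subtopology) auto
  qed
  fix i assume i: "i < m"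
  have "c' i \<in> topspace (punctured_surface g Z)"
    using surf_c i by (auto simp: topspace_config PiE_def Pi_def)
  moreover have "continuous_map (top_of_set surf_pairs) (punctured_surface g Z) (\<lambda>w. gluing g `` {fst w})"
    by (rule coord[of fst]) (auto simp: surf_pairs_def intro: continuous_on_fst continuous_on_id)
  moreover have "continuous_map (top_of_set surf_pairs) (punctured_surface g Z) (\<lambda>w. gluing g `` {snd w})"
    by (rule coord[of snd]) (auto simp: surf_pairs_def intro: continuous_on_snd continuous_on_id)
  ultimately show "continuous_map (top_of_set surf_pairs) (punctured_surface g Z) (\<lambda>w. surf_config w i)"
    using pq'(3) by (cases "i = q"; cases "i = p") (simp_all add: surf_config_def)
next
  fix w assume "w \<in> topspace (top_of_set surf_pairs)"
  then have w: "fst w \<in> cball 0 1 - W" "snd w \<in> cball 0 1 - W" "gluing g `` {fst w} \<noteq> gluing g `` {snd w}"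
    by (auto simp: surf_pairs_def)
  have "inj_on c' {..<m}"
    using surf_c by (simp add: topspace_config)
  then have "inj_on (surf_config w) {..<m}"
    unfolding surf_config_def
    using gluing_class_avoids(2)[OF w(1)] gluing_class_avoids(2)[OF w(2)] w(3) by (rule inj_on_two_updates)
  then show "surf_config w \<in> extensional {..<m} \<and> inj_on (surf_config w) {..<m}"
    using pq' by (simp add: surf_config_def config_map_def extensional_def)
qed

lemma continuous_surf_move: "continuous_map (top_of_set surf_pairs) surf_space surf_move"
  by (rule continuous_map_compose[OF continuous_surf_config continuous_map_orbit])

lemma disc_config_avoids:
  assumes "u \<in> cball 0 (1/2) - W"
  shows "2 * u \<in> cball 0 1 - Z" "2 * u \<notin> c ` ({..<m} - {p, q})"
proof -
  have "2 * u \<notin> Z \<union> c ` ({..<m} - {p, q})"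
  proof
    assume "2 * u \<in> Z \<union> c ` ({..<m} - {p, q})"
    then have "2 * u / 2 \<in> W"
      unfolding W_def by (rule imageI)
    then show False
      using assms by simp
  qed
  moreover have "2 * u \<in> cball 0 1"
    using assms by (simp add: norm_mult)
  ultimately show "2 * u \<in> cball 0 1 - Z" "2 * u \<notin> c ` ({..<m} - {p, q})"
    by auto
qed

lemma punctured_disc_top_of_set: "punctured_disc Z = top_of_set (cball 0 1 - Z)"
  by (simp add: punctured_disc_def disc_def subtopology_subtopology Diff_eq)

lemma continuous_disc_config:
  "continuous_map (top_of_set disc_pairs) (config (punctured_disc Z) m) disc_config"
proof (rule continuous_map_into_config)
  fix i assume i: "i < m"
  have "continuous_map (top_of_set disc_pairs) (punctured_disc Z) (\<lambda>w. 2 * fst w)"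
    "continuous_map (top_of_set disc_pairs) (punctured_disc Z) (\<lambda>w. 2 * snd w)"
    unfolding punctured_disc_top_of_set continuous_map_subtopology_eu
    using disc_config_avoids(1)
    by (safe intro!: continuous_intros, auto simp: disc_pairs_def)+
  then show "continuous_map (top_of_set disc_pairs) (punctured_disc Z) (\<lambda>w. disc_config w i)"
    using c_props(1)[OF i] pq'(3)
    by (cases "i = q"; cases "i = p") (simp_all add: disc_config_def topspace_punctured_disc)
next
  fix w assume "w \<in> topspace (top_of_set disc_pairs)"
  then have w: "fst w \<in> cball 0 (1/2) - W" "snd w \<in> cball 0 (1/2) - W" "2 * fst w \<noteq> 2 * snd w"
    by (auto simp: disc_pairs_def)
  have "inj_on (disc_config w) {..<m}"
    unfolding disc_config_def
    using c_props(2) disc_config_avoids(2)[OF w(1)] disc_config_avoids(2)[OF w(2)] w(3)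
    by (rule inj_on_two_updates)
  then show "disc_config w \<in> extensional {..<m} \<and> inj_on (disc_config w) {..<m}"
    using pq' c_props(3) by (simp add: disc_config_def extensional_def)
qed

lemma continuous_disc_move: "continuous_map (top_of_set disc_pairs) disc_space disc_move"
  by (rule continuous_map_compose[OF continuous_disc_config continuous_map_orbit])

text \<open>The doubling in \<open>disc_config\<close> cancels the halving in
  \<open>disc_embedding\<close>.\<close>

lemma inclusion_disc_move: "inclusion (disc_move w) = surf_move w"
proof -
  have "config_map (disc_embedding g) m (disc_config w) = surf_config w"
    using pq' by (auto simp: fun_eq_iff config_map_def disc_config_def surf_config_def disc_embedding_def)
  then show ?thesis
    using config_map_orbit[OF H, of "disc_embedding g" "disc_config w"] by simp
qed

subsection \<open>The commutator loop on the surface\<close>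

lemma chord_notin_W:
  assumes "u \<in> chord g 0 2 \<or> u \<in> chord g 1 3"
  shows "u \<in> cball 0 1 - W"
proof -
  have "1/2 < cmod u \<and> cmod u \<le> 1"
    using assms norm_chord[OF genus, of u 0] norm_chord[OF genus, of u 1]
    by (auto simp: numeral_2_eq_2 numeral_3_eq_3)
  then show ?thesis
    using W_cball by auto
qed

lemma square_path_surf_pairs:
  assumes "\<tau> \<in> {0..1}"
  shows "square_path g \<tau> \<in> surf_pairs"
proof -
  obtain u v where uv: "square_path g \<tau> = (u, v)"
    by (cases "square_path g \<tau>")
  show ?thesis
    using square_path_chords[OF assms uv] square_path_inequivalent[OF genus assms uv]
      chord_notin_W[of u] chord_notin_W[of v]
    unfolding uv surf_pairs_def by blast
qed

text \<open>Corner \<open>3\<close> is glued to corner \<open>1\<close> and corner \<open>2\<close>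
  to corner \<open>0\<close>, so opposite sides of the square give the same motion traversed
  backwards, and the boundary reads as a commutator.\<close>

lemma commutator_loop_square: "commutator_loop surf_space (surf_move \<circ> square_path g)"
proof -
  let ?b = "linepath (corner g 1) (corner g 3)" and ?a = "linepath (corner g 0) (corner g 2)"
  define \<beta> where "\<beta> = surf_move \<circ> (\<lambda>s. (?b s, corner g 0))"
  define \<alpha> where "\<alpha> = surf_move \<circ> (\<lambda>t. (corner g 1, ?a t))"
  let ?x = "surf_move (corner g 1, corner g 0)"
  have side: "pathin surf_space (surf_move \<circ> w)"
    if w: "path w" "\<And>\<tau>. \<tau> \<in> {0..1} \<Longrightarrow> w \<tau> \<in> surf_pairs" for w
    by (rule pathin_compose[OF _ continuous_surf_move]) (use w in \<open>auto simp: pathin_canon_iff\<close>)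
  have cls: "gluing g `` {corner g 3} = gluing g `` {corner g 1}" "gluing g `` {corner g 2} = gluing g `` {corner g 0}"
    using corner_class[OF genus] by simp_all
  have sub: "(?b s, corner g 0) \<in> surf_pairs" "(corner g 1, ?a s) \<in> surf_pairs" if s: "s \<in> {0..1}" for s
  proof -
    \<comment> \<open>The nested joins traverse the first side during \<open>[0,1/8]\<close> and the
      last one during \<open>[1/2,1]\<close>. Time \<open>1/2\<close> is still evaluated on the
      third side, whence the case \<open>s = 1\<close> below.\<close>
    have "square_path g (s / 8) = (?b s, corner g 0)"
      using s by (simp add: square_path_def join_def)
    then show "(?b s, corner g 0) \<in> surf_pairs"
      using square_path_surf_pairs[of "s / 8"] s by simp
    have "square_path g (1 - s / 2) = (corner g 1, ?a s)"
      using s by (cases "s = 1") (simp_all add: square_path_def join_def linepath_def)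
    then show "(corner g 1, ?a s) \<in> surf_pairs"
      using square_path_surf_pairs[of "1 - s / 2"] s by simp
  qed
  have "path (\<lambda>s. (?b s, corner g 0))" "path (\<lambda>t. (corner g 1, ?a t))"
    unfolding path_def by (intro continuous_intros)+
  then have "pathin surf_space \<beta>" "pathin surf_space \<alpha>"
    unfolding \<alpha>_def \<beta>_def using sub by (auto intro!: side)
  moreover have "\<beta> 0 = ?x" "\<beta> 1 = ?x" "\<alpha> 0 = ?x" "\<alpha> 1 = ?x"
    by (simp_all add: \<alpha>_def \<beta>_def surf_config_def cls linepath_def)
  ultimately have loops: "\<beta> \<in> loops surf_space ?x" "\<alpha> \<in> loops surf_space ?x"
    by (simp_all add: loops_def)
  have "surf_move \<circ> square_path g = join (join (join \<beta> \<alpha>) (rev_path \<beta>)) (rev_path \<alpha>)"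
    by (rule ext)
      (simp add: square_path_def join_def rev_path_def \<alpha>_def \<beta>_def surf_config_def cls linepath_def add.commute)
  then show ?thesis
    using commutator_loop_commutator[OF loops] by simp
qed

text \<open>The boundary of the square scaled by \<open>\<epsilon>\<close> about the crossing point
  \<open>X\<close> and recentred at \<open>y\<close>. Scale \<open>1\<close> and centre
  \<open>X\<close> give back \<open>square_path\<close>.\<close>

definition shrunk :: "complex \<Rightarrow> real \<Rightarrow> complex \<Rightarrow> real \<Rightarrow> complex \<times> complex" where
  "shrunk X \<epsilon> y \<tau> = (y + \<epsilon> *\<^sub>R (fst (square_path g \<tau>) - X), y + \<epsilon> *\<^sub>R (snd (square_path g \<tau>) - X))"

lemma shrunk_inequal: "\<tau> \<in> {0..1} \<Longrightarrow> \<epsilon> \<noteq> 0 \<Longrightarrow> fst (shrunk X \<epsilon> y \<tau>) \<noteq> snd (shrunk X \<epsilon> y \<tau>)"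
  using square_path_inequivalent[OF genus, of \<tau>]
  by (auto simp: shrunk_def) (metis prod.collapse)

text \<open>Points of the chords have norm at most \<open>1\<close> and \<open>X\<close> has norm
  less than \<open>1\<close>, so their distance is less than \<open>2\<close>; this is the source of
  the radius \<open>2 * \<epsilon>\<close> below.\<close>

lemma shrunk_ball:
  assumes "\<tau> \<in> {0..1}" "cmod X < 1" "0 < \<epsilon>" "2 * \<epsilon> \<le> d"
  shows "fst (shrunk X \<epsilon> y \<tau>) \<in> ball y d" "snd (shrunk X \<epsilon> y \<tau>) \<in> ball y d"
proof -
  obtain u v where uv: "square_path g \<tau> = (u, v)"
    by (cases "square_path g \<tau>")
  have "cmod u \<le> 1" "cmod v \<le> 1"
    using square_path_chords[OF assms(1) uv] norm_chord(2)[OF genus, of u 1] norm_chord(2)[OF genus, of v 0]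
    by (simp_all add: numeral_2_eq_2 numeral_3_eq_3)
  then have "cmod (u - X) < 2" "cmod (v - X) < 2"
    using norm_triangle_ineq4[of u X] norm_triangle_ineq4[of v X] assms(2) by linarith+
  then have "\<epsilon> * cmod (u - X) < \<epsilon> * 2" "\<epsilon> * cmod (v - X) < \<epsilon> * 2"
    using assms(3) by simp_all
  then have "\<epsilon> * cmod (u - X) < d" "\<epsilon> * cmod (v - X) < d"
    using assms(4) by linarith+
  then show "fst (shrunk X \<epsilon> y \<tau>) \<in> ball y d" "snd (shrunk X \<epsilon> y \<tau>) \<in> ball y d"
    using assms(3) by (simp_all add: shrunk_def uv dist_norm)
qed

lemma continuous_on_shrunk:
  assumes "continuous_on S e" "continuous_on S y" "continuous_on S t" "t ` S \<subseteq> {0..1}"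
  shows "continuous_on S (\<lambda>s. shrunk X (e s) (y s) (t s))"
proof -
  have "continuous_on S (\<lambda>s. square_path g (t s))"
    by (rule continuous_on_compose2[OF path_square_path[unfolded path_def] assms(3,4)])
  then show ?thesis
    unfolding shrunk_def using assms(1,2) by (intro continuous_intros)
qed

text \<open>Scaling towards \<open>X\<close> keeps each strand on its own chord, hence away from
  \<open>W\<close>. Below scale \<open>1\<close> both strands are inside the open disc, where
  nothing is glued and being distinct suffices; scale \<open>1\<close> is the original
  square.\<close>

lemma commutator_loop_shrunk:
  assumes X: "X \<in> chord g 0 2" "X \<in> chord g 1 3" "cmod X < 1" and \<epsilon>: "0 < \<epsilon>" "\<epsilon> \<le> 1"
  shows "commutator_loop surf_space (\<lambda>\<tau>. surf_move (shrunk X \<epsilon> X \<tau>))"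
proof -
  define F where "F = (\<lambda>w. surf_move (shrunk X (\<epsilon> + fst w * (1 - \<epsilon>)) X (snd w)))"
  have mem: "shrunk X l X \<tau> \<in> surf_pairs" if l: "0 < l" "l \<le> 1" and \<tau>: "\<tau> \<in> {0..1}" for l \<tau>
  proof -
    obtain u v where uv: "square_path g \<tau> = (u, v)"
      by (cases "square_path g \<tau>")
    note ch = square_path_chords[OF \<tau> uv]
    show ?thesis
    proof (cases "l = 1")
      case True
      then show ?thesis
        using square_path_surf_pairs[OF \<tau>] by (simp add: shrunk_def uv)
    next
      case False
      have comb: "X + l *\<^sub>R (w - X) = (1 - l) *\<^sub>R X + l *\<^sub>R w" for w
        by (simp add: algebra_simps)
      have in_chord: "(1 - l) *\<^sub>R X + l *\<^sub>R u \<in> chord g 1 3" "(1 - l) *\<^sub>R X + l *\<^sub>R v \<in> chord g 0 2"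
        using convexD_alt[OF convex_closed_segment X(2), of u l] convexD_alt[OF convex_closed_segment X(1), of v l]
          ch l by simp_all
      have small: "cmod ((1 - l) *\<^sub>R X + l *\<^sub>R w) < 1" if "cmod w \<le> 1" for w
      proof -
        have "cmod ((1 - l) *\<^sub>R X + l *\<^sub>R w) \<le> (1 - l) * cmod X + l * cmod w"
          using norm_triangle_ineq[of "(1 - l) *\<^sub>R X" "l *\<^sub>R w"] l by simp
        also have "\<dots> < (1 - l) * 1 + l * 1"
          using X(3) that l False by (intro add_less_le_mono mult_strict_left_mono mult_left_mono) auto
        finally show ?thesis
          by simp
      qed
      have "cmod u \<le> 1" "cmod v \<le> 1"
        using chord_notin_W[of u] chord_notin_W[of v] ch by auto
      then have "gluing g `` {fst (shrunk X l X \<tau>)} = {fst (shrunk X l X \<tau>)}"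
        "gluing g `` {snd (shrunk X l X \<tau>)} = {snd (shrunk X l X \<tau>)}"
        using small by (simp_all add: gluing_class_inner shrunk_def uv comb)
      moreover have "fst (shrunk X l X \<tau>) \<noteq> snd (shrunk X l X \<tau>)"
        using shrunk_inequal[OF \<tau>] l by simp
      moreover have "fst (shrunk X l X \<tau>) \<in> cball 0 1 - W" "snd (shrunk X l X \<tau>) \<in> cball 0 1 - W"
        using chord_notin_W in_chord by (simp_all add: shrunk_def uv comb)
      ultimately show ?thesis
        by (simp add: surf_pairs_def case_prod_unfold)
    qed
  qed
  have lam: "0 < \<epsilon> + s * (1 - \<epsilon>) \<and> \<epsilon> + s * (1 - \<epsilon>) \<le> 1" if "0 \<le> s" "s \<le> 1" for s
  proof -
    have "0 \<le> s * (1 - \<epsilon>)" "s * (1 - \<epsilon>) \<le> 1 * (1 - \<epsilon>)"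
      using that \<epsilon> by (simp, intro mult_right_mono) auto
    then show ?thesis
      using \<epsilon> by simp
  qed
  have "continuous_map (top_of_set ({0..1} \<times> {0..1})) (top_of_set surf_pairs)
      (\<lambda>w. shrunk X (\<epsilon> + fst w * (1 - \<epsilon>)) X (snd w))"
    using lam mem by (auto intro!: continuous_on_shrunk continuous_intros)
  from continuous_map_compose[OF this continuous_surf_move]
  have F: "continuous_map (top_of_set ({0..1} \<times> {0..1})) surf_space F"
    by (simp add: F_def o_def)
  have "commutator_loop surf_space (\<lambda>\<tau>. F (1, \<tau>))"
    using commutator_loop_square by (simp add: F_def shrunk_def o_def)
  then have "commutator_loop surf_space (\<lambda>\<tau>. F (0, \<tau>))"
    by (rule commutator_loop_free_homotopy[OF F, rotated]) (simp add: F_def shrunk_def)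
  then show ?thesis
    by (simp add: F_def)
qed

text \<open>The small loop is translated along \<open>\<theta>\<close>. The tube of radius
  \<open>2 * \<epsilon>\<close> around \<open>\<theta>\<close> misses \<open>W\<close> and the unit
  circle, so neither obstacles nor gluing interfere.\<close>

lemma commutator_loop_moved:
  assumes X: "X \<in> chord g 0 2" "X \<in> chord g 1 3" "cmod X < 1" and \<epsilon>: "0 < \<epsilon>" "\<epsilon> \<le> 1"
    and \<theta>: "path \<theta>" "\<theta> 1 = X" "\<And>s. s \<in> {0..1} \<Longrightarrow> ball (\<theta> s) (2 * \<epsilon>) \<subseteq> ball 0 1 - W"
  shows "commutator_loop surf_space (\<lambda>\<tau>. surf_move (shrunk X \<epsilon> (\<theta> 0) \<tau>))"
proof -
  define F where "F = (\<lambda>w. surf_move (shrunk X \<epsilon> (\<theta> (fst w)) (snd w)))"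
  have mem: "shrunk X \<epsilon> (\<theta> s) \<tau> \<in> surf_pairs" if s: "s \<in> {0..1}" and \<tau>: "\<tau> \<in> {0..1}" for s \<tau>
  proof -
    have "fst (shrunk X \<epsilon> (\<theta> s) \<tau>) \<in> ball 0 1 - W" "snd (shrunk X \<epsilon> (\<theta> s) \<tau>) \<in> ball 0 1 - W"
      using shrunk_ball[OF \<tau> X(3) \<epsilon>(1) order_refl] \<theta>(3)[OF s] by blast+
    moreover have "fst (shrunk X \<epsilon> (\<theta> s) \<tau>) \<noteq> snd (shrunk X \<epsilon> (\<theta> s) \<tau>)"
      using shrunk_inequal[OF \<tau>] \<epsilon> by simp
    ultimately show ?thesis
      by (simp add: surf_pairs_def case_prod_unfold gluing_class_inner)
  qed
  have "continuous_on ({0..1} \<times> {0..1}) (\<lambda>w::real \<times> real. \<theta> (fst w))"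
    by (rule continuous_on_compose2[OF \<theta>(1)[unfolded path_def]]) (auto intro!: continuous_intros)
  then have "continuous_map (top_of_set ({0..1} \<times> {0..1})) (top_of_set surf_pairs)
      (\<lambda>w. shrunk X \<epsilon> (\<theta> (fst w)) (snd w))"
    using mem by (auto intro!: continuous_on_shrunk continuous_intros)
  from continuous_map_compose[OF this continuous_surf_move]
  have F: "continuous_map (top_of_set ({0..1} \<times> {0..1})) surf_space F"
    by (simp add: F_def o_def)
  have "commutator_loop surf_space (\<lambda>\<tau>. F (1, \<tau>))"
    using commutator_loop_shrunk[OF X \<epsilon>] by (simp add: F_def \<theta>(2))
  then have "commutator_loop surf_space (\<lambda>\<tau>. F (0, \<tau>))"
    by (rule commutator_loop_free_homotopy[OF F, rotated]) (simp add: F_def shrunk_def)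
  then show ?thesis
    by (simp add: F_def)
qed

subsection \<open>The twist in the disc\<close>

lemma pathin_disc_move:
  assumes "path w" "\<And>\<tau>. \<tau> \<in> {0..1} \<Longrightarrow> w \<tau> \<in> disc_pairs"
  shows "pathin disc_space (disc_move \<circ> w)"
  by (rule pathin_compose[OF _ continuous_disc_move]) (use assms in \<open>auto simp: pathin_canon_iff\<close>)

lemma not_collinear_cball: "\<not> collinear (cball (0::complex) (1/2))"
  by (simp add: collinear_aff_dim aff_dim_cball)

text \<open>Strand \<open>p\<close> moves to \<open>u\<close> while \<open>q\<close> waits at its
  base position, and then \<open>q\<close> moves to \<open>v\<close>; this is why \<open>u\<close>
  must differ from \<open>c q / 2\<close>. Each move avoids finitely many points of a
  two-dimensional convex set.\<close>

lemma connect_disc_pairs: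
  assumes u: "u \<in> cball 0 (1/2) - W" "u \<noteq> c q / 2" and v: "v \<in> cball 0 (1/2) - W" and "u \<noteq> v"
  obtains w where "path w" "\<And>\<tau>. \<tau> \<in> {0..1} \<Longrightarrow> w \<tau> \<in> disc_pairs" "w 0 = (c p / 2, c q / 2)" "w 1 = (u, v)"
proof -
  let ?B = "cball (0::complex) (1/2)"
  have cB: "c p / 2 \<in> ?B - W" "c q / 2 \<in> ?B - W"
    using halves_notin_W c_props(1)[OF pq'(1)] c_props(1)[OF pq'(2)] by (simp_all add: norm_divide)
  have conn: "path_connected (?B - insert a W)" for a
    by (rule path_connected_convex_diff_countable)
      (use not_collinear_cball finite_W in \<open>simp_all add: countable_finite\<close>)
  obtain w1 where w1: "path w1" "path_image w1 \<subseteq> ?B - insert (c q / 2) W" "pathstart w1 = c p / 2" "pathfinish w1 = u"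
    using conn[of "c q / 2"] cB u halves_notin_W unfolding path_connected_def by (metis DiffE DiffI insertE)
  obtain w2 where w2: "path w2" "path_image w2 \<subseteq> ?B - insert u W" "pathstart w2 = c q / 2" "pathfinish w2 = v"
    using conn[of u] cB u v \<open>u \<noteq> v\<close> unfolding path_connected_def by (metis DiffE DiffI insertE)
  let ?w1 = "\<lambda>t. (w1 t, c q / 2)" and ?w2 = "\<lambda>t. (u, w2 t)"
  have p: "pathin (top_of_set disc_pairs) ?w1" "pathin (top_of_set disc_pairs) ?w2"
    using w1 w2 cB u
    by (auto simp: pathin_canon_iff path_def disc_pairs_def path_image_def image_subset_iff intro!: continuous_intros)
  have "pathin (top_of_set disc_pairs) (join ?w1 ?w2)"
    using w1 w2 by (intro pathin_join p) (simp add: pathstart_def pathfinish_def)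
  then show thesis
    using w1 w2 by (intro that[of "join ?w1 ?w2"])
      (auto simp: pathin_canon_iff pathstart_def pathfinish_def Pi_iff)
qed

text \<open>For all ordered pairs this is, up to sign, the discriminant of the polynomial with roots
  \<open>d i\<close>; for the pairs between two blocks of strands it is the resultant of the two
  polynomials.\<close>

definition diff_prod :: "(nat \<Rightarrow> complex) \<Rightarrow> complex" where
  "diff_prod d = (\<Prod>r\<in>R. d (fst r) - d (snd r))"

lemma finite_R: "finite R"
  using R by (rule finite_subset) simp

text \<open>\<open>\<pi>\<close> acts injectively on the finite set \<open>R\<close>, hence
  bijectively, and merely reorders the factors.\<close>

lemma diff_prod_perm:
  assumes "\<pi> \<in> H"
  shows "diff_prod (d \<circ> \<pi>) = diff_prod d"
proof -
  have "inj \<pi>"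
    using assms H permutes_inj by blast
  then have inj: "inj_on (map_prod \<pi> \<pi>) R"
    using map_prod_inj_on[of \<pi> UNIV \<pi> UNIV] by (auto intro: inj_on_subset)
  moreover have "map_prod \<pi> \<pi> ` R \<subseteq> R"
    using R_H[OF assms] by auto
  ultimately have im: "map_prod \<pi> \<pi> ` R = R"
    using finite_R by (simp add: endo_inj_surj)
  have "diff_prod d = (\<Prod>r\<in>map_prod \<pi> \<pi> ` R. d (fst r) - d (snd r))"
    by (simp add: diff_prod_def im)
  also have "\<dots> = diff_prod (d \<circ> \<pi>)"
    by (simp add: prod.reindex[OF inj] diff_prod_def)
  finally show ?thesis ..
qed

lemma diff_prod_lift:
  obtains f where "continuous_map disc_space (top_of_set (- {0})) f"
    "\<And>d. d \<in> topspace (config (punctured_disc Z) m) \<Longrightarrow> f (orbit H d) = diff_prod d"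
proof -
  let ?C = "config (punctured_disc Z) m"
  have proj: "continuous_map ?C euclidean (\<lambda>d. d i)" if "i < m" for i
    using continuous_map_config_proj[OF that, of "punctured_disc Z"]
    unfolding punctured_disc_top_of_set by (rule continuous_map_into_fulltopology)
  have "continuous_map ?C euclidean (\<lambda>d. d (fst r) - d (snd r))" if "r \<in> R" for r
    using that R by (intro continuous_map_diff proj) auto
  then have cont: "continuous_map ?C euclidean diff_prod"
    unfolding diff_prod_def[abs_def] by (simp add: continuous_map_atin tendsto_prod)
  have nz: "diff_prod d \<noteq> 0" if d: "d \<in> topspace ?C" for d
  proof -
    have inj: "inj_on d {..<m}"
      using d by (simp add: topspace_config)
    have "d (fst r) - d (snd r) \<noteq> 0" if r: "r \<in> R" for r
    proof -
      have "fst r < m" "snd r < m" "fst r \<noteq> snd r"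
        using r R R_irrefl[of "fst r"] by auto
      then show ?thesis
        using inj_onD[OF inj, of "fst r" "snd r"] by auto
    qed
    then show ?thesis
      by (simp add: diff_prod_def finite_R)
  qed
  have cont': "continuous_map ?C (top_of_set (- {0})) diff_prod"
    using cont nz by (intro continuous_map_into_subtopology) auto
  have inv: "diff_prod d = diff_prod e" if eq: "orbit H d = orbit H e" for d e
  proof -
    \<comment> \<open>The identity in \<open>H\<close> puts \<open>d\<close> into its own orbit, so
      equal orbits yield \<open>d = e \<circ> \<pi>\<close>.\<close>
    have "d \<circ> id \<in> orbit H d"
      unfolding orbit_def by (rule imageI[OF id_H])
    then have "d \<in> (\<lambda>\<pi>. e \<circ> \<pi>) ` H"
      using eq by (simp add: orbit_def)
    then obtain \<pi> where "d = e \<circ> \<pi>" "\<pi> \<in> H"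
      by (rule imageE)
    then show ?thesis
      using diff_prod_perm by simp
  qed
  show thesis
    by (rule quotient_map_lift_exists[OF quotient_map_orbit[of "punctured_disc Z" m H] cont'])
      (use inv that in blast)+
qed

text \<open>The winding is a sum over the factors. The pairs \<open>(p, q)\<close> and, if present,
  \<open>(q, p)\<close> count positively; a pair with one moving strand stays in a convex set
  missing \<open>0\<close>; a pair at rest is constant.\<close>

lemma winding_number_twist:
  assumes X: "cmod X < 1" and \<epsilon>: "0 < \<epsilon>"
    and ball: "ball y (2 * \<epsilon>) \<subseteq> ball 0 (1/2) - W"
    and mem: "\<And>\<tau>. \<tau> \<in> {0..1} \<Longrightarrow> shrunk X \<epsilon> y \<tau> \<in> disc_pairs"
  shows "0 < Re (winding_number (\<lambda>\<tau>. diff_prod (disc_config (shrunk X \<epsilon> y \<tau>))) 0)"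
proof -
  let ?w = "shrunk X \<epsilon> y"
  define D where "D i j = (\<lambda>\<tau>. disc_config (?w \<tau>) i - disc_config (?w \<tau>) j)" for i j
  have cw: "continuous_on {0..1} ?w"
    by (intro continuous_on_shrunk continuous_intros) auto
  have cont: "continuous_on {0..1} (\<lambda>\<tau>. disc_config (?w \<tau>) i)" for i
    using pq'(3) by (cases "i = q"; cases "i = p") (auto simp: disc_config_def intro!: continuous_intros cw)
  have path: "path (D i j)" for i j
    unfolding path_def D_def by (intro continuous_intros cont)
  have nz: "0 \<notin> path_image (D i j)" if "(i, j) \<in> R" for i j
  proof
    assume "0 \<in> path_image (D i j)"
    then obtain \<tau> where \<tau>: "\<tau> \<in> {0..1}" "disc_config (?w \<tau>) i = disc_config (?w \<tau>) j"
      by (auto simp: path_image_def D_def)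
    have "disc_config (?w \<tau>) \<in> topspace (config (punctured_disc Z) m)"
      using continuous_disc_config mem[OF \<tau>(1)] by (simp add: continuous_map_def Pi_iff)
    then have "inj_on (disc_config (?w \<tau>)) {..<m}"
      by (simp add: topspace_config)
    then have "i = j"
      using \<tau>(2) that R by (auto dest: inj_onD)
    then show False
      using that R_irrefl by simp
  qed
  have dist2: "dist (2 * a) (2 * b) = 2 * dist a b" for a b :: complex
  proof -
    have "2 * a - 2 * b = 2 * (a - b)"
      by (rule right_diff_distrib[symmetric])
    then show ?thesis
      by (simp only: dist_norm norm_mult norm_numeral)
  qed
  \<comment> \<open>Radius \<open>4 * \<epsilon>\<close> is the radius of \<open>shrunk_ball\<close>
    doubled by \<open>disc_config\<close>.\<close>
  have ball2: "2 * fst (?w \<tau>) \<in> ball (2 * y) (4 * \<epsilon>)" "2 * snd (?w \<tau>) \<in> ball (2 * y) (4 * \<epsilon>)" if "\<tau> \<in> {0..1}" for \<tau>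
    using shrunk_ball[OF that X \<epsilon> order_refl, of y] by (simp_all add: dist2)
  have far: "c j \<notin> ball (2 * y) (4 * \<epsilon>)" if "j < m" "j \<noteq> p" "j \<noteq> q" for j
  proof
    assume "c j \<in> ball (2 * y) (4 * \<epsilon>)"
    then have "c j / 2 \<in> ball y (2 * \<epsilon>)"
      using dist2[of y "c j / 2"] by simp
    moreover have "c j / 2 \<in> W"
      using that by (auto simp: W_def)
    ultimately show False
      using ball by blast
  qed
  have ends: "D i j 1 = D i j 0" for i j
    by (simp add: D_def shrunk_def)
  have single: "winding_number (D i j) 0 = 0"
    if ij: "(i, j) \<in> R" "(i, j) \<noteq> (p, q)" "(i, j) \<noteq> (q, p)" for i j
  proof -
    have m: "i < m" "j < m" "i \<noteq> j"
      using ij(1) R R_irrefl[of i] by auto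
    consider "i \<in> {p, q}" "j \<notin> {p, q}" | "i \<notin> {p, q}" "j \<in> {p, q}" | "i \<notin> {p, q}" "j \<notin> {p, q}"
      using ij m by auto
    then show ?thesis
    proof cases
      case 1
      have "D i j \<tau> \<in> (\<lambda>z. z - c j) ` ball (2 * y) (4 * \<epsilon>)" if "\<tau> \<in> {0..1}" for \<tau>
        using 1 ball2[OF that] pq'(3) by (auto simp: D_def disc_config_def)
      moreover have "0 \<notin> (\<lambda>z. z - c j) ` ball (2 * y) (4 * \<epsilon>)"
        using far[OF m(2)] 1 by auto
      moreover have "convex ((\<lambda>z. z - c j) ` ball (2 * y) (4 * \<epsilon>))"
        by (intro convex_translation_subtract convex_ball)
      ultimately show ?thesis
        using path ends by (intro winding_number_zero_outside) (auto simp: path_image_def pathstart_def pathfinish_def)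
    next
      case 2
      have "D i j \<tau> \<in> (\<lambda>z. c i - z) ` ball (2 * y) (4 * \<epsilon>)" if "\<tau> \<in> {0..1}" for \<tau>
        using 2 ball2[OF that] pq'(3) by (auto simp: D_def disc_config_def)
      moreover have "0 \<notin> (\<lambda>z. c i - z) ` ball (2 * y) (4 * \<epsilon>)"
        using far[OF m(1)] 2 by auto
      moreover have "(\<lambda>z. c i - z) ` ball (2 * y) (4 * \<epsilon>) = (\<lambda>z. c i + z) ` (uminus ` ball (2 * y) (4 * \<epsilon>))"
        by (simp add: image_image)
      then have "convex ((\<lambda>z. c i - z) ` ball (2 * y) (4 * \<epsilon>))"
        by (simp add: convex_translation convex_negations)
      ultimately show ?thesis
        using path ends by (intro winding_number_zero_outside) (auto simp: path_image_def pathstart_def pathfinish_def)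
    next
      case 3
      then have "D i j = (\<lambda>_. c i - c j)"
        by (simp add: D_def disc_config_def)
      moreover have "c i \<noteq> c j"
        using m inj_onD[OF c_props(2), of i j] by auto
      ultimately show ?thesis
        by (simp add: winding_number_zero_const)
    qed
  qed
  have main: "0 < Re (winding_number (D i j) 0)" if "(i, j) = (p, q) \<or> (i, j) = (q, p)" for i j
  proof -
    have "D p q = (\<lambda>\<tau>. (2 * \<epsilon>) *\<^sub>R (fst (square_path g \<tau>) - snd (square_path g \<tau>)))"
      "D q p = (\<lambda>\<tau>. (- 2 * \<epsilon>) *\<^sub>R (fst (square_path g \<tau>) - snd (square_path g \<tau>)))"
      using pq'(3) by (auto simp: D_def disc_config_def shrunk_def fun_eq_iff scaleR_conv_of_real algebra_simps)
    then show ?thesis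
      using that square_path_winding[OF genus, of "2 * \<epsilon>"] square_path_winding[OF genus, of "- 2 * \<epsilon>"] \<epsilon> by auto
  qed
  have "winding_number (\<lambda>\<tau>. diff_prod (disc_config (?w \<tau>))) 0 = (\<Sum>r\<in>R. winding_number (D (fst r) (snd r)) 0)"
    using winding_number_prod[OF finite_R, of "\<lambda>r. D (fst r) (snd r)"] path nz
    by (simp add: diff_prod_def D_def)
  also have "Re \<dots> = (\<Sum>r\<in>R. Re (winding_number (D (fst r) (snd r)) 0))"
    by simp
  also have "\<dots> > 0"
  proof (rule sum_pos2[OF finite_R pq])
    show "0 < Re (winding_number (D (fst (p, q)) (snd (p, q))) 0)"
      using main[of p q] by simp
    fix r assume "r \<in> R"
    then show "0 \<le> Re (winding_number (D (fst r) (snd r)) 0)"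
      using single[of "fst r" "snd r"] main[of "fst r" "snd r"]
      by (cases "r = (p, q) \<or> r = (q, p)") auto
  qed
  finally show ?thesis .
qed

section \<open>Placing the twist and evaluating it on both sides\<close>

lemma twist_position:
  obtains X \<epsilon> \<theta> y where "X \<in> chord g 0 2" "X \<in> chord g 1 3" "cmod X < 1" "0 < \<epsilon>" "\<epsilon> \<le> 1"
    "path \<theta>" "\<theta> 0 = y" "\<theta> 1 = X" "\<And>s. s \<in> {0..1} \<Longrightarrow> ball (\<theta> s) (2 * \<epsilon>) \<subseteq> ball 0 1 - W"
    "ball y (2 * \<epsilon>) \<subseteq> ball 0 (1/2) - insert (c q / 2) W"
proof -
  obtain X where X: "X \<in> chord g 0 2" "X \<in> chord g 1 3" "cmod X < 1"
    using chords_cross[OF genus] by blast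
  \<comment> \<open>The base position of \<open>q\<close> is excluded as well, because strand
    \<open>p\<close> is brought near \<open>y\<close> while \<open>q\<close> still rests
    there.\<close>
  let ?W = "insert (c q / 2) W"
  have "uncountable (ball (0::complex) (1/2))"
    by (rule uncountable_ball) simp
  then have "\<not> ball 0 (1/2) \<subseteq> ?W"
    using finite_W countable_subset[of "ball 0 (1/2)" ?W] by (auto simp: countable_finite)
  then obtain y where y: "y \<in> ball 0 (1/2) - ?W"
    by blast
  have "open (ball 0 (1/2) - ?W)"
    using finite_W by (intro open_Diff open_ball finite_imp_closed) simp
  then obtain r where r: "0 < r" "ball y r \<subseteq> ball 0 (1/2) - ?W"
    using y openE by blast
  have "path_connected (ball 0 1 - W)"
    using finite_W by (intro path_connected_open_diff_countable) (auto simp: countable_finite)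
  moreover have "y \<in> ball 0 1 - W" "X \<in> ball 0 1 - W"
    using y X chord_notin_W[of X] by auto
  ultimately obtain \<theta> where \<theta>: "path \<theta>" "path_image \<theta> \<subseteq> ball 0 1 - W" "pathstart \<theta> = y" "pathfinish \<theta> = X"
    unfolding path_connected_def by blast
  have "closed (- (ball 0 1 - W))"
    using finite_W by (intro closed_Compl open_Diff open_ball finite_imp_closed)
  then obtain d where d: "0 < d" "\<And>x z. x \<in> path_image \<theta> \<Longrightarrow> z \<in> - (ball 0 1 - W) \<Longrightarrow> d \<le> dist x z"
    using separate_compact_closed[OF compact_path_image[OF \<theta>(1)], of "- (ball 0 1 - W)"] \<theta>(2) by blast
  \<comment> \<open>Twice \<open>\<epsilon>\<close> must fit into the clearance \<open>d\<close> of
    the path and into the radius \<open>r\<close> around \<open>y\<close>; the bound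
    \<open>1\<close> makes the loop a shrinking of the square.\<close>
  define \<epsilon> where "\<epsilon> = min 1 (min d r / 2)"
  have \<epsilon>: "0 < \<epsilon>" "\<epsilon> \<le> 1" "2 * \<epsilon> \<le> d" "2 * \<epsilon> \<le> r"
    using r(1) d(1) by (auto simp: \<epsilon>_def min_def)
  have "ball (\<theta> s) (2 * \<epsilon>) \<subseteq> ball 0 1 - W" if "s \<in> {0..1}" for s
  proof
    fix z assume "z \<in> ball (\<theta> s) (2 * \<epsilon>)"
    then have "dist (\<theta> s) z < d"
      using \<epsilon>(3) by simp
    moreover have "\<theta> s \<in> path_image \<theta>"
      using that by (simp add: path_image_def)
    ultimately show "z \<in> ball 0 1 - W"
      using d(2)[of "\<theta> s" z] by fastforce
  qed
  moreover have "ball y (2 * \<epsilon>) \<subseteq> ball 0 (1/2) - ?W"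
    using r(2) subset_ball[OF \<epsilon>(4), of y] by blast
  ultimately show thesis
    using that[of X \<epsilon> \<theta> y] X \<epsilon>(1,2) \<theta> by (simp add: pathstart_def pathfinish_def)
qed

text \<open>The element is the twist near \<open>y\<close>, conjugated to the base point by a path
  in the disc. Its image on the surface is a conjugate of the transported commutator, while
  conjugation does not alter its winding in the disc.\<close>

lemma twist_class:
  obtains x where "x \<in> carrier (pi1 disc_space (orbit H c))"
    "x \<notin> Gamma2 (pi1 disc_space (orbit H c))"
    "pi1_map surf_space (orbit H c') inclusion x \<in> Gamma2 (pi1 surf_space (orbit H c'))"
proof -
  obtain X \<epsilon> \<theta> y where X: "X \<in> chord g 0 2" "X \<in> chord g 1 3" "cmod X < 1" and \<epsilon>: "0 < \<epsilon>" "\<epsilon> \<le> 1"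
    and \<theta>: "path \<theta>" "\<theta> 0 = y" "\<theta> 1 = X" "\<And>s. s \<in> {0..1} \<Longrightarrow> ball (\<theta> s) (2 * \<epsilon>) \<subseteq> ball 0 1 - W"
    and y: "ball y (2 * \<epsilon>) \<subseteq> ball 0 (1/2) - insert (c q / 2) W"
    by (rule twist_position) (rule that; assumption)
  let ?w = "shrunk X \<epsilon> y"
  have near: "fst (?w \<tau>) \<in> ball 0 (1/2) - insert (c q / 2) W" "snd (?w \<tau>) \<in> ball 0 (1/2) - W"
    if "\<tau> \<in> {0..1}" for \<tau>
    using shrunk_ball[OF that X(3) \<epsilon>(1) order_refl, of y] y by blast+
  have mem: "?w \<tau> \<in> disc_pairs" if "\<tau> \<in> {0..1}" for \<tau>
    using near[OF that] shrunk_inequal[OF that, of \<epsilon> X y] \<epsilon> by (auto simp: disc_pairs_def case_prod_unfold)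
  have path: "path ?w"
    unfolding path_def by (intro continuous_on_shrunk continuous_intros) auto
  have w01: "?w 1 = ?w 0"
    by (simp add: shrunk_def)
  obtain \<delta> where \<delta>: "path \<delta>" "\<And>\<tau>. \<tau> \<in> {0..1} \<Longrightarrow> \<delta> \<tau> \<in> disc_pairs" "\<delta> 0 = (c p / 2, c q / 2)" "\<delta> 1 = ?w 0"
    using connect_disc_pairs[of "fst (?w 0)" "snd (?w 0)"] near[of 0] shrunk_inequal[of 0 \<epsilon> X y] \<epsilon>
    by auto
  let ?\<tau> = "disc_move \<circ> \<delta>" and ?\<zeta> = "disc_move \<circ> ?w"
  define \<gamma> where "\<gamma> = conj_path ?\<tau> ?\<zeta>"
  have p: "pathin disc_space ?\<tau>" "pathin disc_space ?\<zeta>"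
    by (rule pathin_disc_move[OF \<delta>(1,2)], assumption, rule pathin_disc_move[OF path mem])
  have "disc_config (\<delta> 0) = c"
    by (auto simp: \<delta>(3) disc_config_def)
  then have base: "?\<tau> 0 = orbit H c"
    by simp
  have \<gamma>: "\<gamma> \<in> loops disc_space (orbit H c)"
    unfolding \<gamma>_def
    by (rule conj_path_loop[OF _ p(1) base]) (use p(2) w01 in \<open>auto simp: loops_def \<delta>(4)\<close>)
  have incl: "inclusion \<circ> (disc_move \<circ> f) = surf_move \<circ> f" for f :: "real \<Rightarrow> complex \<times> complex"
    using inclusion_disc_move by (auto simp: fun_eq_iff)
  have "commutator_loop surf_space (inclusion \<circ> ?\<zeta>)"
    using commutator_loop_moved[OF X \<epsilon> \<theta>(1,3,4)] unfolding incl by (simp add: \<theta>(2) o_def)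
  then have "commutator_loop surf_space (conj_path (inclusion \<circ> ?\<tau>) (inclusion \<circ> ?\<zeta>))"
    by (rule commutator_loop_conj[OF _ pathin_compose[OF p(1) continuous_inclusion]]) (simp add: \<delta>(4))
  then have "commutator_loop surf_space (inclusion \<circ> \<gamma>)"
    by (simp only: \<gamma>_def conj_path_compose)
  moreover have "(inclusion \<circ> \<gamma>) 0 = orbit H c'"
    using base inclusion_base by (simp add: \<gamma>_def)
  ultimately have comm: "loop_class surf_space (orbit H c') (inclusion \<circ> \<gamma>) \<in> Gamma2 (pi1 surf_space (orbit H c'))"
    unfolding commutator_loop_def by metis
  obtain f where f: "continuous_map disc_space (top_of_set (- {0})) f"
    "\<And>d. d \<in> topspace (config (punctured_disc Z) m) \<Longrightarrow> f (orbit H d) = diff_prod d"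
    by (rule diff_prod_lift) (rule that; assumption)
  have f\<zeta>: "(f \<circ> ?\<zeta>) t = diff_prod (disc_config (?w t))" if "t \<in> {0..1}" for t
    using f(2) continuous_disc_config mem[OF that] by (simp add: continuous_map_def Pi_iff)
  have "winding_number (f \<circ> ?\<zeta>) 0 = winding_number (\<lambda>t. diff_prod (disc_config (?w t))) 0"
    by (rule winding_number_cong) (use f\<zeta> in auto)
  then have wind: "0 < Re (winding_number (f \<circ> ?\<zeta>) 0)"
    using winding_number_twist[OF X(3) \<epsilon>(1) _ mem] y by auto
  let ?a = "f \<circ> ?\<tau>" and ?z = "f \<circ> ?\<zeta>"
  have a: "path ?a" "0 \<notin> path_image ?a" and z: "path ?z" "0 \<notin> path_image ?z"
    using pathin_compose[OF p(1) f(1)] pathin_compose[OF p(2) f(1)]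
    by (auto simp: pathin_canon_iff path_image_def)
  have ends: "pathfinish ?a = pathstart ?z" "pathfinish ?z = pathfinish ?a"
    using w01 by (simp_all add: pathstart_def pathfinish_def \<delta>(4))
  \<comment> \<open>The contributions of \<open>?a\<close> and of its reverse cancel.\<close>
  have "f \<circ> \<gamma> = (?a +++ ?z) +++ reversepath ?a"
    unfolding \<gamma>_def conj_path_compose
    by (simp only: conj_path_def join_eq_joinpaths rev_path_def reversepath_def)
  then have "winding_number (f \<circ> \<gamma>) 0 = winding_number ?z 0"
    using a z ends by (simp add: winding_number_join winding_number_reversepath path_image_join)
  then have "winding_number (f \<circ> \<gamma>) 0 \<noteq> 0"
    using wind by auto
  then have "loop_class disc_space (orbit H c) \<gamma> \<notin> Gamma2 (pi1 disc_space (orbit H c))"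
    by (rule loop_class_notin_derived[OF f(1) \<gamma>])
  then show thesis
    using that[of "loop_class disc_space (orbit H c) \<gamma>"] comm
    by (simp add: loop_class_carrier[OF \<gamma>] pi1_map_class[OF \<gamma> continuous_inclusion inclusion_base])
qed

lemma inclusion_not_injective:
  fixes G :: "('h, 'm) monoid_scheme"
  assumes G: "comm_group G"
  defines "B \<equiv> pi1 disc_space (orbit H c)" and "B' \<equiv> pi1 surf_space (orbit H c')"
    and "\<iota> \<equiv> pi1_map surf_space (orbit H c') inclusion"
  shows "(\<forall>P Pbar. P \<in> hom B' G \<longrightarrow> Pbar \<in> hom (abelianization B) G \<longrightarrow>
            (\<forall>x\<in>carrier B. P (\<iota> x) = Pbar (ab_proj B x)) \<longrightarrow>
            \<not> inj_on Pbar (carrier (abelianization B))) \<and>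
         \<not> inj_on (ab_map B' \<iota>) (carrier (abelianization B))"
proof -
  obtain x where x: "x \<in> carrier B" "x \<notin> Gamma2 B" "\<iota> x \<in> Gamma2 B'"
    using twist_class unfolding B_def B'_def \<iota>_def by blast
  have B: "group B" and B': "group B'"
    unfolding B_def B'_def using c surf_c by (auto intro!: group_pi1 simp: topspace_config_quotient)
  have "\<iota> \<in> hom B B'"
    unfolding B_def B'_def \<iota>_def by (rule pi1_map_hom[OF continuous_inclusion inclusion_base])
  from abelianization_not_injective[OF B B' this G x] show ?thesis .
qed

end

section \<open>Mixed braids, and braids of the punctured disc\<close>

theorem corollary3p5:
  fixes g k :: nat and G :: "('h, 'm) monoid_scheme"
  assumes "g \<ge> 1" and "k \<ge> 1" and "comm_group G"
  shows
    "(\<forall>n c.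
        n \<ge> 1 \<longrightarrow> c \<in> topspace (config disc (k + n)) \<longrightarrow>
        (let B = mixed_braid_group disc k n c;
             B' = mixed_braid_group (surface g) k n (config_map (disc_embedding g) (k + n) c);
             \<iota> = mixed_braid_map (surface g) k n c (disc_embedding g)
         in (\<forall>P Pbar. P \<in> hom B' G \<longrightarrow> Pbar \<in> hom (abelianization B) G \<longrightarrow>
               (\<forall>x\<in>carrier B. P (\<iota> x) = Pbar (ab_proj B x)) \<longrightarrow>
               \<not> inj_on Pbar (carrier (abelianization B))) \<and>
            \<not> inj_on (ab_map B' \<iota>) (carrier (abelianization B))))
     \<and>
     (\<forall>n Z c.
        finite Z \<longrightarrow> card Z = n \<longrightarrow> Z \<subseteq> ball 0 1 \<longrightarrow>
        c \<in> topspace (config (punctured_disc Z) k) \<longrightarrow>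
        (let B = braid_group (punctured_disc Z) k c;
             B' = braid_group (punctured_surface g Z) k (config_map (disc_embedding g) k c);
             \<iota> = braid_map (punctured_surface g Z) k c (disc_embedding g)
         in (k = 1 \<longrightarrow> inj_on (ab_map B' \<iota>) (carrier (abelianization B))) \<and>
            (k \<ge> 2 \<longrightarrow>
               (\<forall>P Pbar. P \<in> hom B' G \<longrightarrow> Pbar \<in> hom (abelianization B) G \<longrightarrow>
                  (\<forall>x\<in>carrier B. P (\<iota> x) = Pbar (ab_proj B x)) \<longrightarrow>
                  \<not> inj_on Pbar (carrier (abelianization B))) \<and>
               \<not> inj_on (ab_map B' \<iota>) (carrier (abelianization B)))))"
proof (intro conjI allI impI)
  fix n :: nat and c :: "nat \<Rightarrow> complex"
  assume n: "n \<ge> 1" and c: "c \<in> topspace (config disc (k + n))"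
  \<comment> \<open>Mixed braids are the case of the empty puncture set, with the block-preserving
    permutations as \<open>H\<close>.\<close>
  have disc: "punctured_disc {} = disc" and surf: "punctured_surface g {} = surface g"
    by (simp_all add: punctured_disc_def punctured_surface_def)
  have stable: "\<pi> i < k \<longleftrightarrow> i < k" if "\<pi> \<in> mixed_perms k n" for \<pi> i
  proof -
    have "inj \<pi>" "\<pi> ` {..<k} = {..<k}"
      using that permutes_inj by (auto simp: mixed_perms_def)
    then show ?thesis
      by (metis inj_image_mem_iff lessThan_iff)
  qed
  \<comment> \<open>Strands \<open>0\<close> and \<open>k\<close> are the first ones of the two
    blocks. Mixed permutations preserve both blocks and hence the set of pairs from the first to the
    second.\<close>
  have "two_strands g (k + n) {} (mixed_perms k n) ({..<k} \<times> {k..<k + n}) c 0 k"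
  proof
    fix \<pi> i j assume \<pi>: "\<pi> \<in> mixed_perms k n" and ij: "(i, j) \<in> {..<k} \<times> {k..<k + n}"
    have "\<pi> permutes {..<k + n}"
      using \<pi> by (simp add: mixed_perms_def)
    then have "\<pi> j < k + n"
      using ij permutes_in_image[of \<pi> "{..<k + n}" j] by simp
    then show "(\<pi> i, \<pi> j) \<in> {..<k} \<times> {k..<k + n}"
      using stable[OF \<pi>, of i] stable[OF \<pi>, of j] ij by auto
  qed (use assms n c disc in \<open>auto simp: mixed_perms_def permutes_id\<close>)
  note two_strands.inclusion_not_injective[OF this assms(3), unfolded disc surf]
  then show "let B = mixed_braid_group disc k n c;
             B' = mixed_braid_group (surface g) k n (config_map (disc_embedding g) (k + n) c);
             \<iota> = mixed_braid_map (surface g) k n c (disc_embedding g)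
         in (\<forall>P Pbar. P \<in> hom B' G \<longrightarrow> Pbar \<in> hom (abelianization B) G \<longrightarrow>
               (\<forall>x\<in>carrier B. P (\<iota> x) = Pbar (ab_proj B x)) \<longrightarrow>
               \<not> inj_on Pbar (carrier (abelianization B))) \<and>
            \<not> inj_on (ab_map B' \<iota>) (carrier (abelianization B))"
    unfolding Let_def mixed_braid_group_def mixed_braid_map_def .
next
  fix n :: nat and Z :: "complex set" and c :: "nat \<Rightarrow> complex"
  assume Z: "finite Z" "Z \<subseteq> ball 0 1" and c: "c \<in> topspace (config (punctured_disc Z) k)"
  let ?B = "braid_group (punctured_disc Z) k c"
  let ?B' = "braid_group (punctured_surface g Z) k (config_map (disc_embedding g) k c)"
  let ?\<iota> = "braid_map (punctured_surface g Z) k c (disc_embedding g)"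
  have one: "k = 1 \<longrightarrow> inj_on (ab_map ?B' ?\<iota>) (carrier (abelianization ?B))"
    using one_strand_injective[OF Z(2), of c g] c by blast
  have many: "(\<forall>P Pbar. P \<in> hom ?B' G \<longrightarrow> Pbar \<in> hom (abelianization ?B) G \<longrightarrow>
                  (\<forall>x\<in>carrier ?B. P (?\<iota> x) = Pbar (ab_proj ?B x)) \<longrightarrow>
                  \<not> inj_on Pbar (carrier (abelianization ?B))) \<and>
               \<not> inj_on (ab_map ?B' ?\<iota>) (carrier (abelianization ?B))" if k: "k \<ge> 2"
  proof -
    \<comment> \<open>With at least two strands, \<open>0\<close> and \<open>1\<close> can be
      twisted; all ordered pairs of distinct indices form a set invariant under every
      permutation.\<close>
    have "two_strands g k Z (perms k) {(i, j). i < k \<and> j < k \<and> i \<noteq> j} c 0 1"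
    proof
      fix \<pi> i j assume \<pi>: "\<pi> \<in> perms k" and ij: "(i, j) \<in> {(i, j). i < k \<and> j < k \<and> i \<noteq> j}"
      have "\<pi> permutes {..<k}"
        using \<pi> by (simp add: perms_def)
      then show "(\<pi> i, \<pi> j) \<in> {(i, j). i < k \<and> j < k \<and> i \<noteq> j}"
        using ij permutes_in_image[of \<pi> "{..<k}"] inj_eq[OF permutes_inj, of \<pi> "{..<k}" i j] by simp
    qed (use assms Z c k in \<open>auto simp: perms_def permutes_id\<close>)
    from two_strands.inclusion_not_injective[OF this assms(3)] show ?thesis
      unfolding braid_group_def braid_map_def .
  qed
  show "let B = ?B; B' = ?B'; \<iota> = ?\<iota>
         in (k = 1 \<longrightarrow> inj_on (ab_map B' \<iota>) (carrier (abelianization B))) \<and>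
            (k \<ge> 2 \<longrightarrow>
               (\<forall>P Pbar. P \<in> hom B' G \<longrightarrow> Pbar \<in> hom (abelianization B) G \<longrightarrow>
                  (\<forall>x\<in>carrier B. P (\<iota> x) = Pbar (ab_proj B x)) \<longrightarrow>
                  \<not> inj_on Pbar (carrier (abelianization B))) \<and>
               \<not> inj_on (ab_map B' \<iota>) (carrier (abelianization B)))"
    using one many by (simp only: Let_def) blast
qed

end
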